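(* For integers $b>1$ let $c_b(n)$ be the number of convex domino towers consisting of $n$ dominoes whose row of maximum length has $b$ dominoes, and let $\theta_b=\lim_{n\to\infty} c_b(n)/2^n$ (so that $c_b(n)\sim\theta_b 2^n$ as $n\to\infty$). Then, as $b\to\infty$, $$\theta_b \sim \left(\tfrac12\right)^{b-1}\prod_{k=1}^{b-1}\frac{2^k}{2^k-1},$$ and consequently $\theta_b\sim P\left(\tfrac12\right)^{b-1}$ as $b\to\infty$, where $P=\prod_{k=1}^{\infty}\frac{2^k}{2^k-1}$ equals $3.46$ when rounded to two decimal places.
   Context: Cells are unit squares indexed by $(x,y)\in\mathbb{Z}^2$; a domino occupies a pair of cells $\{(x,y),(x+1,y)\}$; dominoes in a configuration do not overlap. For $n\ge b'\ge 1$, an $(n,b')$-domino tower is a polyomino (counted up to translation only) created by taking a base of $b'$ consecutive dominoes in a single row (a contiguous horizontal strip of $2b'$ cells) and sequentially placing $n-b'$ further horizontal dominoes so that if a non-base domino is placed at $\{(x,y),(x+1,y)\}$ then there is a domino at $\{(x-1,y-1),(x,y-1)\}$, $\{(x,y-1),(x+1,y-1)\}$ or $\{(x+1,y-1),(x+2,y-1)\}$. A domino tower is an $(n,b')$-domino tower for some $n,b'$. A row (column) is the intersection of the polyomino with an infinite horizontal (vertical) line of unit squares; the tower is convex if every row and every column consists of consecutive cells. The length of a row is its number of dominoes. Here $u\sim v$ means that the ratio $u/v$ tends to $1$. The limit defining $\theta_b$ exists and is nonzero for each $b>1$. *)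

theory Defs
  imports "HOL-Analysis.Analysis" "HOL-Library.Landau_Symbols"
begin

type_synonym cell = "int \<times> int"

definition domino :: "int \<Rightarrow> int \<Rightarrow> cell set" where
  "domino x y = {(x, y), (x + 1, y)}"

text \<open>\<open>domino_tower n b' D\<close>: the set of dominoes \<open>D\<close> arises from a base of \<open>b'\<close> consecutive
  dominoes by successively placing \<open>n - b'\<close> further, non-overlapping and supported, dominoes.
  The polyomino itself is the set of cells \<open>\<Union>D\<close>.\<close>

inductive domino_tower :: "nat \<Rightarrow> nat \<Rightarrow> cell set set \<Rightarrow> bool" where
  base: "b' \<ge> 1 \<Longrightarrow> domino_tower b' b' ((\<lambda>i. domino (x + 2 * int i) y) ` {..<b'})"
| place: "domino_tower n b' D \<Longrightarrow> domino x y \<inter> \<Union>D = {} \<Longrightarrow>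
    domino (x - 1) (y - 1) \<in> D \<or> domino x (y - 1) \<in> D \<or> domino (x + 1) (y - 1) \<in> D \<Longrightarrow>
    domino_tower (Suc n) b' (insert (domino x y) D)"

definition convex_polyomino :: "cell set \<Rightarrow> bool" where
  "convex_polyomino S \<longleftrightarrow>
     (\<forall>y x1 x x2. (x1, y) \<in> S \<longrightarrow> (x2, y) \<in> S \<longrightarrow> x1 \<le> x \<longrightarrow> x \<le> x2 \<longrightarrow> (x, y) \<in> S) \<and>
     (\<forall>x y1 y y2. (x, y1) \<in> S \<longrightarrow> (x, y2) \<in> S \<longrightarrow> y1 \<le> y \<longrightarrow> y \<le> y2 \<longrightarrow> (x, y) \<in> S)"

definition row_length :: "cell set set \<Rightarrow> int \<Rightarrow> nat" where
  "row_length D y = card {x. domino x y \<in> D}"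

definition translation_rel :: "(cell set \<times> cell set) set" where
  "translation_rel = {(S, T). \<exists>u v. T = (\<lambda>(x, y). (x + u, y + v)) ` S}"

definition convex_tower_polyominoes :: "nat \<Rightarrow> nat \<Rightarrow> cell set set" where
  "convex_tower_polyominoes b n =
     {\<Union>D | D. (\<exists>b'. domino_tower n b' D) \<and> convex_polyomino (\<Union>D) \<and>
                Max (range (row_length D)) = b}"

definition num_convex_towers :: "nat \<Rightarrow> nat \<Rightarrow> nat" where
  "num_convex_towers b n = card (convex_tower_polyominoes b n // translation_rel)"

text \<open>Meaningful only where the limit exists.\<close>

definition tower_theta :: "nat \<Rightarrow> real" where
  "tower_theta b = lim (\<lambda>n. real (num_convex_towers b n) / 2 ^ n)"

text \<open>The product over \<open>k \<ge> 1\<close>, shifted to start at index 0.\<close>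

definition tower_P :: real where
  "tower_P = (\<Prod>k. 2 ^ Suc k / (2 ^ Suc k - 1))"

end

theory Submission
  imports Defs "HOL-Real_Asymp.Real_Asymp"
begin

text \<open>
  A convex tower is read from bottom to top as a base length followed by the lengths of the
  later rows together with the shifts of their left ends.  Convexity says that the left end, once it
  has moved right, never moves left again, and symmetrically for the right end.  While neither has
  retreated, the row length can grow, by at most one per row; once an end has retreated, it cannot.
  A state with exactly one retreated end offers two ways to repeat a row, so a tail of single
  dominoes leaning to one side accounts for the growth rate \<open>2\<^sup>n\<close>; towers in which both ends have
  retreated are negligible.  After division by \<open>2\<^sup>n\<close> every count obeys a recurrence
  \<open>u n = q * u (n - k) + d n\<close> with \<open>\<bar>q\<bar> < 1\<close> and convergent \<open>d\<close>, except for leaning single dominoes, where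
  it is constant.  Solving for the limits gives
  \<open>\<theta>\<^sub>b = (1/2)^(b-1) * (\<Prod>k=1..b-1. 2^k / (2^k - 1)) * H\<^sub>b\<close>, where \<open>H\<^sub>b\<close> weighs the possible ascents to
  the first row of length \<open>b\<close>, satisfies \<open>H\<^sub>1 = 1\<close> and \<open>H\<^bsub>b+1\<^esub> = 1 + H\<^sub>b / (2^b - 1)\<close>, and so tends to \<open>1\<close>.
\<close>

subsection \<open>Stacks of rows\<close>

definition row_cells :: "int \<Rightarrow> int \<Rightarrow> nat \<Rightarrow> cell set" where
  "row_cells l y k = {l..<l + 2 * int k} \<times> {y}"

definition row_dominoes :: "int \<Rightarrow> int \<Rightarrow> nat \<Rightarrow> cell set set" where
  "row_dominoes l y k = (\<lambda>i. domino (l + 2 * int i) y) ` {..<k}"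

text \<open>The pairs \<open>(k', s)\<close> such that a row of \<open>k'\<close> dominoes whose left end is shifted by \<open>s\<close> may follow
  a row of \<open>k\<close> dominoes; \<open>lf\<close> and \<open>rf\<close> record that the left end has earlier moved strictly right and
  that the right end has earlier moved strictly left.\<close>

definition steps :: "bool \<Rightarrow> bool \<Rightarrow> nat \<Rightarrow> (nat \<times> int) set" where
  "steps lf rf k = (SIGMA k':{1..k+1}.
     {(if lf then 0 else -1)..2 * int k - 2 * int k' + (if rf then 0 else 1)})"

text \<open>Only shifts are recorded, never positions, so a profile is blind to translation.
  Measured from the old left end, the right ends of the two rows are at \<open>2 * int k\<close> and
  \<open>s + 2 * int k'\<close>, whence the test for \<open>rf\<close>.\<close>

fun profile :: "bool \<Rightarrow> bool \<Rightarrow> nat \<Rightarrow> (nat \<times> int) list \<Rightarrow> bool" where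
  "profile lf rf k [] \<longleftrightarrow> True"
| "profile lf rf k ((k', s) # ws) \<longleftrightarrow> (k', s) \<in> steps lf rf k \<and>
     profile (lf \<or> 0 < s) (rf \<or> s + 2 * int k' < 2 * int k) k' ws"

text \<open>With both flags down, \<open>steps\<close> expresses mere support: each domino of the
  new row overlaps the row below. Column convexity is what \<open>profile\<close> adds.\<close>

fun supported :: "nat \<Rightarrow> (nat \<times> int) list \<Rightarrow> bool" where
  "supported k [] \<longleftrightarrow> True"
| "supported k ((k', s) # ws) \<longleftrightarrow> (k', s) \<in> steps False False k \<and> supported k' ws"

fun stack_cells :: "int \<Rightarrow> int \<Rightarrow> nat \<Rightarrow> (nat \<times> int) list \<Rightarrow> cell set" where
  "stack_cells l y k [] = row_cells l y k"
| "stack_cells l y k ((k', s) # ws) = row_cells l y k \<union> stack_cells (l + s) (y + 1) k' ws"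

fun stack_dominoes :: "int \<Rightarrow> int \<Rightarrow> nat \<Rightarrow> (nat \<times> int) list \<Rightarrow> cell set set" where
  "stack_dominoes l y k [] = row_dominoes l y k"
| "stack_dominoes l y k ((k', s) # ws) =
     row_dominoes l y k \<union> stack_dominoes (l + s) (y + 1) k' ws"

lemma domino_inject [simp]: "domino x y = domino x' y' \<longleftrightarrow> x = x' \<and> y = y'"
  by (auto simp: domino_def doubleton_eq_iff)

lemma mem_steps:
  "(k', s) \<in> steps lf rf k \<longleftrightarrow> 1 \<le> k' \<and> -1 \<le> s \<and> s + 2 * int k' \<le> 2 * int k + 1 \<and>
     (lf \<longrightarrow> 0 \<le> s) \<and> (rf \<longrightarrow> s + 2 * int k' \<le> 2 * int k)"
  by (auto simp: steps_def)

lemma mem_row_cells: "(x, y') \<in> row_cells l y k \<longleftrightarrow> y' = y \<and> l \<le> x \<and> x < l + 2 * int k"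
  by (auto simp: row_cells_def)

lemma mem_row_dominoes:
  "domino x y' \<in> row_dominoes l y k \<longleftrightarrow> y' = y \<and> (\<exists>i<k. x = l + 2 * int i)"
  by (auto simp: row_dominoes_def)

lemma Union_row_dominoes: "\<Union>(row_dominoes l y k) = row_cells l y k"
proof -
  have "\<exists>i<k. x = l + 2 * int i \<or> x = l + 2 * int i + 1"
    if "l \<le> x" "x < l + 2 * int k" for x
    using that by (intro exI[of _ "nat ((x - l) div 2)"]) linarith
  then show ?thesis
    unfolding row_dominoes_def row_cells_def domino_def by (auto simp: Bex_def)
qed

lemma Union_stack_dominoes: "\<Union>(stack_dominoes l y k ws) = stack_cells l y k ws"
  by (induction l y k ws rule: stack_cells.induct) (simp_all add: Union_row_dominoes)

lemma profile_imp_supported: "profile lf rf k ws \<Longrightarrow> supported k ws"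
  by (induction lf rf k ws rule: profile.induct) (auto simp: mem_steps)

lemma stack_cells_ge: "(x, y') \<in> stack_cells l y k ws \<Longrightarrow> y \<le> y'"
  by (induction l y k ws rule: stack_cells.induct) (force simp: mem_row_cells)+

lemma stack_dominoes_ge: "domino x y' \<in> stack_dominoes l y k ws \<Longrightarrow> y \<le> y'"
  by (induction l y k ws rule: stack_dominoes.induct) (force simp: mem_row_dominoes)+

text \<open>Flags never come down, and \<open>steps\<close> keeps a flagged end from moving
  outwards, so an end that has retreated is a wall for all later rows.\<close>

lemma profile_stack_cells_bounds:
  assumes "profile lf rf k ws" "k \<ge> 1" "(x, y') \<in> stack_cells l y k ws"
  shows "lf \<longrightarrow> l \<le> x" "rf \<longrightarrow> x < l + 2 * int k"
  using assms
  by (induction lf rf k ws arbitrary: l y rule: profile.induct)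
    (fastforce simp: mem_row_cells mem_steps)+

lemma profile_imp_convex:
  assumes "profile lf rf k ws" "k \<ge> 1"
  shows "convex_polyomino (stack_cells l y k ws)"
  using assms
proof (induction lf rf k ws arbitrary: l y rule: profile.induct)
  case (1 lf rf k)
  then show ?case by (auto simp: convex_polyomino_def mem_row_cells)
next
  case (2 lf rf k k' s ws)
  let ?T = "stack_cells (l + s) (y + 1) k' ws"
  have st: "(k', s) \<in> steps lf rf k"
    and pr: "profile (lf \<or> 0 < s) (rf \<or> s + 2 * int k' < 2 * int k) k' ws"
    using 2 by auto
  have k': "k' \<ge> 1" using st by (simp add: mem_steps)
  have IH: "convex_polyomino ?T" using 2 k' pr by blast
  have ge: "(x, y') \<in> ?T \<Longrightarrow> y + 1 \<le> y'" for x y' by (rule stack_cells_ge)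
  \<comment> \<open>If the second row missed column \<open>x\<close>, the end on that side would
    have retreated past \<open>x\<close>, and the raised flag would keep every later row away from
    it.\<close>
  have bottom: "(x, y + 1) \<in> ?T" if "(x, y) \<in> row_cells l y k" "(x, y2) \<in> ?T" for x y2
  proof -
    have "l + s \<le> x \<and> x < l + s + 2 * int k'"
      using profile_stack_cells_bounds[OF pr k' that(2)] that(1) by (auto simp: mem_row_cells)
    then show ?thesis by (cases ws) (auto simp: mem_row_cells)
  qed
  show ?case unfolding convex_polyomino_def
  proof (intro conjI allI impI)
    fix y' x1 x x2
    assume *: "(x1, y') \<in> stack_cells l y k ((k', s) # ws)"
      "(x2, y') \<in> stack_cells l y k ((k', s) # ws)" "x1 \<le> x" "x \<le> x2"
    show "(x, y') \<in> stack_cells l y k ((k', s) # ws)"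
    proof (cases "y' = y")
      case True
      then show ?thesis using * ge[of x1 y] ge[of x2 y] by (auto simp: mem_row_cells)
    next
      case False
      then have "(x1, y') \<in> ?T" "(x2, y') \<in> ?T" using * by (auto simp: mem_row_cells)
      then have "(x, y') \<in> ?T" using IH *(3,4) unfolding convex_polyomino_def by blast
      then show ?thesis by simp
    qed
  next
    fix x y1 y' y2
    assume *: "(x, y1) \<in> stack_cells l y k ((k', s) # ws)"
      "(x, y2) \<in> stack_cells l y k ((k', s) # ws)" "y1 \<le> y'" "y' \<le> y2"
    show "(x, y') \<in> stack_cells l y k ((k', s) # ws)"
    proof (cases "y' = y1")
      case True
      then show ?thesis using * by simp
    next
      case False
      then have "y1 < y2" "y1 + 1 \<le> y'" using * by auto
      moreover have "y \<le> y1" using stack_cells_ge[OF *(1)] .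
      ultimately have t2: "(x, y2) \<in> ?T" using * by (auto simp: mem_row_cells)
      \<comment> \<open>Convexity of the upper stack fills the column between its cells, so one cell
        at height at most \<open>y'\<close> suffices; \<open>bottom\<close> supplies it when the
        segment starts in the bottom row.\<close>
      have "\<exists>y3\<le>y'. (x, y3) \<in> ?T"
      proof (cases "(x, y1) \<in> ?T")
        case False
        then have "(x, y1) \<in> row_cells l y k" using *(1) by simp
        then have "y1 = y" "(x, y) \<in> row_cells l y k" by (auto simp: mem_row_cells)
        then show ?thesis using bottom[OF _ t2] \<open>y1 + 1 \<le> y'\<close> by blast
      qed (use *(3) in blast)
      then have "(x, y') \<in> ?T" using IH t2 *(4) unfolding convex_polyomino_def by blast
      then show ?thesis by simp
    qed
  qed
qed

text \<open>A discrete intermediate value argument: each end of a row moves outwards by at most one cell.\<close>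

lemma supported_left_bound:
  assumes "supported k ws" "k \<ge> 1" "c \<le> l" "\<And>y'. (c - 1, y') \<notin> stack_cells l y k ws"
    "(x, y') \<in> stack_cells l y k ws"
  shows "c \<le> x"
  using assms
proof (induction k ws arbitrary: l y rule: supported.induct)
  case (2 k k' s ws)
  have "(c - 1, y + 1) \<notin> stack_cells (l + s) (y + 1) k' ws" using 2(5) by auto
  \<comment> \<open>Since \<open>s >= -1\<close> and \<open>c <= l\<close>, a crossing would put the
    left end exactly on column \<open>c - 1\<close>, which is empty.\<close>
  then have "c \<noteq> l + s + 1" using 2(2) by (cases ws) (auto simp: mem_row_cells mem_steps)
  then have "c \<le> l + s" using 2 by (auto simp: mem_steps)
  then show ?case using 2 by (auto simp: mem_steps mem_row_cells)
qed (auto simp: mem_row_cells)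

lemma supported_right_bound:
  assumes "supported k ws" "k \<ge> 1" "l + 2 * int k \<le> c" "\<And>y'. (c, y') \<notin> stack_cells l y k ws"
    "(x, y') \<in> stack_cells l y k ws"
  shows "x < c"
  using assms
proof (induction k ws arbitrary: l y rule: supported.induct)
  case (2 k k' s ws)
  have "(c, y + 1) \<notin> stack_cells (l + s) (y + 1) k' ws" using 2(5) by auto
  then have "c \<noteq> l + s + 2 * int k' - 1"
    using 2(2) by (cases ws) (auto simp: mem_row_cells mem_steps)
  then have "l + s + 2 * int k' \<le> c" using 2 by (auto simp: mem_steps)
  then show ?case using 2 by (auto simp: mem_steps mem_row_cells)
qed (auto simp: mem_row_cells)

text \<open>Induction upwards forgets the rows already passed; the hypotheses on \<open>lf\<close>
  and \<open>rf\<close> retain what those rows forbid, namely cells beyond an end that has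
  retreated.\<close>

lemma convex_imp_profile:
  assumes "supported k ws" "k \<ge> 1" "convex_polyomino (stack_cells l y k ws)"
    "lf \<Longrightarrow> \<forall>(x, y') \<in> stack_cells l y k ws. l \<le> x"
    "rf \<Longrightarrow> \<forall>(x, y') \<in> stack_cells l y k ws. x < l + 2 * int k"
  shows "profile lf rf k ws"
  using assms
proof (induction k ws arbitrary: l y lf rf rule: supported.induct)
  case (2 k k' s ws)
  let ?T = "stack_cells (l + s) (y + 1) k' ws"
  let ?S = "stack_cells l y k ((k', s) # ws)"
  have st: "(k', s) \<in> steps False False k" and k': "k' \<ge> 1" and su: "supported k' ws"
    using 2 by (auto simp: mem_steps)
  have ge: "(x, y') \<in> ?T \<Longrightarrow> y + 1 \<le> y'" for x y' by (rule stack_cells_ge)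
  have sub: "row_cells (l + s) (y + 1) k' \<subseteq> ?T" by (cases ws) auto
  have T: "(x, y') \<in> ?T \<longleftrightarrow> (x, y') \<in> ?S \<and> y + 1 \<le> y'" for x y'
    using ge[of x y'] by (auto simp: mem_row_cells)
  have conv: "convex_polyomino ?T"
    using 2(4) unfolding convex_polyomino_def T
    by (smt (verit, best))
  have Trow: "(x, y + 1) \<in> ?T \<Longrightarrow> (x, y + 1) \<in> row_cells (l + s) (y + 1) k'" for x
    using stack_cells_ge[of x "y+1" _ "y + 1 + 1"] by (cases ws) fastforce+
  \<comment> \<open>A column of the bottom row that skips the second row cannot resume higher up
    without breaking column convexity.\<close>
  have gap: "(x, y') \<notin> ?T" if "(x, y) \<in> row_cells l y k" "(x, y + 1) \<notin> ?T" for x y'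
  proof
    assume "(x, y') \<in> ?T"
    then have "y + 1 \<le> y'" "(x, y') \<in> ?S" using ge by auto
    moreover have "(x, y) \<in> ?S" using that by simp
    ultimately have "(x, y + 1) \<in> ?S"
      using 2(4) unfolding convex_polyomino_def by (meson le_add_same_cancel1 zero_le_one)
    then show False using that(2) T[of x "y + 1"] by blast
  qed
  have mem: "(k', s) \<in> steps lf rf k"
  proof -
    have "(l + s, y + 1) \<in> ?S" "(l + s + 2 * int k' - 1, y + 1) \<in> ?S"
      using k' sub[THEN subsetD] by (simp_all add: mem_row_cells)
    then show ?thesis using 2(5,6) st by (fastforce simp: mem_steps)
  qed
  \<comment> \<open>After a move to the right, the column just left of the second row is such a gap,
    and left ends moving outwards by at most one cell cannot jump it. Otherwise \<open>lf\<close> is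
    up and \<open>s = 0\<close>, so the old bound carries over.\<close>
  have L: "\<forall>(x, y') \<in> ?T. l + s \<le> x" if "lf \<or> 0 < s"
  proof (cases "0 < s")
    case True
    have "(l + s - 1, y) \<in> row_cells l y k" using st True k' by (auto simp: mem_steps mem_row_cells)
    moreover have "(l + s - 1, y + 1) \<notin> ?T" using Trow[of "l + s - 1"] by (auto simp: mem_row_cells)
    ultimately show ?thesis using supported_left_bound[OF su k' order_refl gap] by blast
  next
    case False
    then show ?thesis using that 2(5) mem T by (fastforce simp: mem_steps)
  qed
  have R: "\<forall>(x, y') \<in> ?T. x < l + s + 2 * int k'" if "rf \<or> s + 2 * int k' < 2 * int k"
  proof (cases "s + 2 * int k' < 2 * int k")
    case True
    have "(l + s + 2 * int k', y) \<in> row_cells l y k"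
      using st True k' by (auto simp: mem_steps mem_row_cells)
    moreover have "(l + s + 2 * int k', y + 1) \<notin> ?T"
      using Trow[of "l + s + 2 * int k'"] by (auto simp: mem_row_cells)
    ultimately show ?thesis using supported_right_bound[OF su k' order_refl gap] by blast
  next
    case False
    then have "l + 2 * int k = l + s + 2 * int k'" using that mem by (auto simp: mem_steps)
    moreover have rf using that False by simp
    ultimately have eq: "l + 2 * int k = l + s + 2 * int k'" and rf by simp_all
    show ?thesis
    proof clarify
      fix x y' assume "(x, y') \<in> ?T"
      then have "(x, y') \<in> ?S" using T by blast
      from bspec[OF 2(6)[OF \<open>rf\<close>] this] show "x < l + s + 2 * int k'" using eq by simp
    qed
  qed
  show ?case using mem 2(1)[OF su k' conv L R] by simp
qed simp

subsection \<open>Convex towers as stacks\<close>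

text \<open>\<open>X\<close> stands for the left ends of the dominoes in one row; the second
  hypothesis is disjointness, the third row convexity. The induction adds the rightmost
  domino.\<close>

lemma consecutive_dominoes:
  fixes X :: "int set"
  assumes "finite X" "\<And>x. x \<in> X \<Longrightarrow> x + 1 \<notin> X"
    "\<And>x1 x x2. x1 \<in> X \<Longrightarrow> x2 \<in> X \<Longrightarrow> x1 \<le> x \<Longrightarrow> x \<le> x2 \<Longrightarrow> x \<in> X \<or> x - 1 \<in> X"
  shows "\<exists>l k. X = (\<lambda>i. l + 2 * int i) ` {..<k}"
  using assms
proof (induction X rule: finite_linorder_max_induct)
  case empty
  show ?case by (intro exI[of _ 0]) simp
next
  case (insert b A)
  have "x \<in> A \<or> x - 1 \<in> A" if "x1 \<in> A" "x2 \<in> A" "x1 \<le> x" "x \<le> x2" for x1 x x2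
    using insert.prems(2)[of x1 x2 x] insert.hyps(2) that by force
  then obtain l k where A: "A = (\<lambda>i. l + 2 * int i) ` {..<k}"
    using insert.IH insert.prems(1) by (metis insertCI)
  show ?case
  proof (cases k)
    case 0
    then have "insert b A = (\<lambda>i. b + 2 * int i) ` {..<1}" using A by auto
    then show ?thesis by blast
  next
    case (Suc j)
    let ?m = "l + 2 * int j"
    have m: "?m \<in> A" and le: "\<And>x. x \<in> A \<Longrightarrow> x \<le> ?m" using A Suc by auto
    have "?m < b" "b \<noteq> ?m + 1" using m insert.hyps(2) insert.prems(1)[of ?m] by auto
    \<comment> \<open>The cell right after the domino at \<open>?m\<close> must be covered, and a
      domino starting at \<open>?m + 1\<close> would overlap that one.\<close>
    then have "?m + 2 \<in> insert b A \<or> ?m + 1 \<in> insert b A"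
      using insert.prems(2)[of ?m b "?m + 2"] m by (simp add: algebra_simps)
    moreover have "?m + 2 \<notin> A" "?m + 1 \<notin> A" using le[of "?m + 2"] le[of "?m + 1"] by auto
    ultimately have "b = ?m + 2" using \<open>b \<noteq> ?m + 1\<close> by blast
    then have "b = l + 2 * int k" using Suc by simp
    then have "insert b A = (\<lambda>i. l + 2 * int i) ` {..<Suc k}"
      using A by (simp add: lessThan_Suc)
    then show ?thesis by blast
  qed
qed

text \<open>The static properties of the domino set of a tower that do not refer to the order of placement;
  the base row is at height \<open>y\<close>.\<close>

definition resting_on :: "int \<Rightarrow> cell set set \<Rightarrow> bool" where
  "resting_on y D \<longleftrightarrow> finite D \<and> (\<forall>d\<in>D. \<exists>x y'. d = domino x y' \<and> y \<le> y') \<and>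
     (\<forall>x y'. domino x y' \<in> D \<longrightarrow> domino (x + 1) y' \<notin> D) \<and>
     (\<forall>x y'. domino x y' \<in> D \<longrightarrow> y < y' \<longrightarrow>
        domino (x - 1) (y' - 1) \<in> D \<or> domino x (y' - 1) \<in> D \<or> domino (x + 1) (y' - 1) \<in> D)"

text \<open>Every placed domino has one beneath it and so lies strictly above the base height; hence
  the base row stays as it was.\<close>

lemma domino_tower_resting_on:
  assumes "domino_tower n b D"
  shows "card D = n \<and> b \<ge> 1 \<and>
    (\<exists>x y. resting_on y D \<and> {x'. domino x' y \<in> D} = (\<lambda>i. x + 2 * int i) ` {..<b})"
  using assms
proof induction
  case (base b x y)
  have "inj_on (\<lambda>i. domino (x + 2 * int i) y) {..<b}" by (auto simp: inj_on_def)
  moreover have "resting_on y ((\<lambda>i. domino (x + 2 * int i) y) ` {..<b})"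
    by (auto simp: resting_on_def) presburger
  moreover have "{x'. domino x' y \<in> (\<lambda>i. domino (x + 2 * int i) y) ` {..<b}} =
      (\<lambda>i. x + 2 * int i) ` {..<b}" by auto
  ultimately show ?case using base by (simp add: card_image) blast
next
  case (place n b D x y)
  then obtain x0 y0 where D: "card D = n" "b \<ge> 1" "resting_on y0 D"
    "{x'. domino x' y0 \<in> D} = (\<lambda>i. x0 + 2 * int i) ` {..<b}" by blast
  have new: "domino x' y \<notin> D" if "x' = x - 1 \<or> x' = x \<or> x' = x + 1" for x'
  proof
    assume "domino x' y \<in> D"
    moreover have "domino x' y \<inter> domino x y \<noteq> {}" using that by (auto simp: domino_def)
    ultimately show False using place.hyps(2) by blast
  qed
  have fin: "finite D" using D by (simp add: resting_on_def)
  have above: "y0 < y"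
  proof -
    obtain x' where "domino x' (y - 1) \<in> D" using place.hyps(3) by blast
    then show ?thesis using D(3) unfolding resting_on_def by fastforce
  qed
  have "resting_on y0 (insert (domino x y) D)"
    unfolding resting_on_def
  proof (intro conjI allI impI ballI)
    fix d assume "d \<in> insert (domino x y) D"
    then show "\<exists>x y'. d = domino x y' \<and> y0 \<le> y'"
      using D(3) less_imp_le[OF above] unfolding resting_on_def by blast
  next
    fix x' y' assume "domino x' y' \<in> insert (domino x y) D"
    then show "domino (x' + 1) y' \<notin> insert (domino x y) D"
      using D(3) new unfolding resting_on_def by (auto simp: eq_diff_eq)
  next
    fix x' y' assume "domino x' y' \<in> insert (domino x y) D" "y0 < y'"
    then show "domino (x' - 1) (y' - 1) \<in> insert (domino x y) D \<or>
      domino x' (y' - 1) \<in> insert (domino x y) D \<or> domino (x' + 1) (y' - 1) \<in> insert (domino x y) D"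
      using D(3) place.hyps(3) unfolding resting_on_def by auto
  qed (simp add: fin)
  moreover have "{x'. domino x' y0 \<in> insert (domino x y) D} = {x'. domino x' y0 \<in> D}"
    using above by auto
  ultimately show ?case using D fin new[of x] by auto
qed

lemma convex_polyomino_above:
  assumes "convex_polyomino S"
  shows "convex_polyomino {c \<in> S. y \<le> snd c}"
  using assms unfolding convex_polyomino_def mem_Collect_eq snd_conv by (smt (verit, best))

text \<open>Peel off the bottom row and recurse on the rest \<open>?E\<close>, which again rests on
  its own lowest row; row convexity makes that row a single block.\<close>

lemma resting_on_imp_stack:
  assumes "resting_on y D" "convex_polyomino (\<Union>D)"
    "{x. domino x y \<in> D} = (\<lambda>i. l + 2 * int i) ` {..<k}" "k \<ge> 1"
  shows "\<exists>ws. supported k ws \<and> D = stack_dominoes l y k ws"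
  using assms
proof (induction "card D" arbitrary: D l y k rule: less_induct)
  case less
  have fin: "finite D"
    and ex: "\<And>d. d \<in> D \<Longrightarrow> \<exists>x y'. d = domino x y' \<and> y \<le> y'"
    and disj: "\<And>x y'. domino x y' \<in> D \<Longrightarrow> domino (x + 1) y' \<notin> D"
    and supp: "\<And>x y'. domino x y' \<in> D \<Longrightarrow> y < y' \<Longrightarrow>
      domino (x - 1) (y' - 1) \<in> D \<or> domino x (y' - 1) \<in> D \<or> domino (x + 1) (y' - 1) \<in> D"
    using less.prems(1) unfolding resting_on_def by auto
  have base: "domino x y \<in> D \<longleftrightarrow> domino x y \<in> row_dominoes l y k" for x
    using less.prems(3) by (auto simp: mem_row_dominoes set_eq_iff)
  have row_sub: "row_dominoes l y k \<subseteq> D"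
    using base by (auto simp: row_dominoes_def)
  have mem: "(x, y') \<in> \<Union>D \<longleftrightarrow> domino x y' \<in> D \<or> domino (x - 1) y' \<in> D" for x y'
  proof
    assume "(x, y') \<in> \<Union>D"
    then obtain x1 y1 where "domino x1 y1 \<in> D" "(x, y') \<in> domino x1 y1" using ex by blast
    then show "domino x y' \<in> D \<or> domino (x - 1) y' \<in> D" by (auto simp: domino_def)
  next
    assume "domino x y' \<in> D \<or> domino (x - 1) y' \<in> D"
    moreover have "(x, y') \<in> domino x y'" "(x, y') \<in> domino (x - 1) y'"
      by (simp_all add: domino_def)
    ultimately show "(x, y') \<in> \<Union>D" by blast
  qed
  let ?E = "{d \<in> D. d \<notin> row_dominoes l y k}"
  have E: "domino x y' \<in> ?E \<longleftrightarrow> domino x y' \<in> D \<and> y + 1 \<le> y'" for x y'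
  proof -
    have "y \<le> y'" if "domino x y' \<in> D" using ex[OF that] by auto
    then show ?thesis using base[of x] by (cases "y' = y") (auto simp: mem_row_dominoes)
  qed
  have D_eq: "D = row_dominoes l y k \<union> ?E" using row_sub by auto
  show ?case
  proof (cases "?E = {}")
    case True
    then have "D = stack_dominoes l y k []" using D_eq unfolding True by simp
    then show ?thesis by (metis supported.simps(1))
  next
    case False
    have "domino l y \<in> D" using base[of l] less.prems(4) by (auto simp: mem_row_dominoes)
    then have smaller: "card ?E < card D"
      using base[of l] fin by (intro psubset_card_mono) auto
    have rest: "resting_on (y + 1) ?E"
      unfolding resting_on_def
    proof (intro conjI allI impI ballI)
      fix d assume "d \<in> ?E"
      then show "\<exists>x y'. d = domino x y' \<and> y + 1 \<le> y'"
        using ex[of d] E by blast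
    next
      fix x y' assume "domino x y' \<in> ?E"
      then show "domino (x + 1) y' \<notin> ?E" using disj by blast
    next
      fix x y' assume "domino x y' \<in> ?E" "y + 1 < y'"
      moreover from this have "domino (x - 1) (y' - 1) \<in> D \<or> domino x (y' - 1) \<in> D \<or>
        domino (x + 1) (y' - 1) \<in> D" using supp[of x y'] by auto
      ultimately show "domino (x - 1) (y' - 1) \<in> ?E \<or> domino x (y' - 1) \<in> ?E \<or>
        domino (x + 1) (y' - 1) \<in> ?E" unfolding E by linarith
    qed (simp add: fin)
    have "\<Union>?E = {c \<in> \<Union>D. y + 1 \<le> snd c}"
    proof -
      have "c \<in> \<Union>?E \<longleftrightarrow> c \<in> \<Union>D \<and> y + 1 \<le> snd c" for c
      proof
        assume "c \<in> \<Union>?E"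
        then obtain d where d: "d \<in> ?E" "c \<in> d" by blast
        then obtain x y' where "d = domino x y'" "y + 1 \<le> y'"
          using rest unfolding resting_on_def by blast
        then show "c \<in> \<Union>D \<and> y + 1 \<le> snd c" using d by (auto simp: domino_def)
      next
        assume c: "c \<in> \<Union>D \<and> y + 1 \<le> snd c"
        then obtain d where d: "d \<in> D" "c \<in> d" by blast
        then obtain x y' where "d = domino x y'" using ex by blast
        then show "c \<in> \<Union>?E" using d c E[of x y'] by (intro UnionI[of d]) (auto simp: domino_def)
      qed
      then show ?thesis by blast
    qed
    then have conv: "convex_polyomino (\<Union>?E)"
      using convex_polyomino_above[OF less.prems(2)] by simp
    let ?X = "{x. domino x (y + 1) \<in> ?E}"
    have X: "?X = {x. domino x (y + 1) \<in> D}" using E by simp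
    have finX: "finite ?X"
    proof -
      have "(\<lambda>x. domino x (y + 1)) ` ?X \<subseteq> D" by blast
      then have "finite ((\<lambda>x. domino x (y + 1)) ` ?X)" using fin finite_subset by blast
      then show ?thesis by (rule finite_imageD) (simp add: inj_on_def)
    qed
    have convX: "x \<in> ?X \<or> x - 1 \<in> ?X" if "x1 \<in> ?X" "x2 \<in> ?X" "x1 \<le> x" "x \<le> x2" for x1 x x2
    proof -
      have "(x1, y + 1) \<in> \<Union>D" "(x2, y + 1) \<in> \<Union>D" using that unfolding mem X by blast+
      then have "(x, y + 1) \<in> \<Union>D"
        using less.prems(2) that(3,4) unfolding convex_polyomino_def by blast
      then show ?thesis unfolding mem X by simp
    qed
    have sepX: "x + 1 \<notin> ?X" if "x \<in> ?X" for x using disj that by blast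
    have "\<exists>l' k'. ?X = (\<lambda>i. l' + 2 * int i) ` {..<k'}"
    proof (rule consecutive_dominoes[OF finX])
      show "\<And>x. x \<in> ?X \<Longrightarrow> x + 1 \<notin> ?X" by (rule sepX)
      show "\<And>x1 x x2. x1 \<in> ?X \<Longrightarrow> x2 \<in> ?X \<Longrightarrow> x1 \<le> x \<Longrightarrow> x \<le> x2 \<Longrightarrow> x \<in> ?X \<or> x - 1 \<in> ?X"
        by (rule convX)
    qed
    then obtain l' k' where lk: "?X = (\<lambda>i. l' + 2 * int i) ` {..<k'}" by blast
    \<comment> \<open>A remaining domino of least height must be at \<open>y + 1\<close>: any
      higher, its support would be a lower remaining domino.\<close>
    have "?X \<noteq> {}"
    proof -
      have "\<exists>h. \<exists>x. domino x (y + 1 + int h) \<in> ?E"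
      proof -
        obtain d where "d \<in> ?E" using False by blast
        moreover from this obtain x y' where "d = domino x y'" "y + 1 \<le> y'"
          using rest unfolding resting_on_def by blast
        ultimately have "domino x y' \<in> ?E" by simp
        moreover obtain h where "y' = y + 1 + int h"
          using \<open>y + 1 \<le> y'\<close> zle_iff_zadd[of "y + 1" y'] by auto
        ultimately show ?thesis by blast
      qed
      then obtain h x where h: "domino x (y + 1 + int h) \<in> ?E"
        and min: "\<And>h' x. h' < h \<Longrightarrow> domino x (y + 1 + int h') \<notin> ?E"
        using exists_least_iff[of "\<lambda>h. \<exists>x. domino x (y + 1 + int h) \<in> ?E"] by blast
      have "h = 0"
      proof (rule ccontr)
        assume "h \<noteq> 0"
        then have less: "y + 1 < y + 1 + int h"
          and pred: "y + 1 + int h - 1 = y + 1 + int (h - 1)" "h - 1 < h" by auto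
        have "domino (x - 1) (y + 1 + int h - 1) \<in> ?E \<or> domino x (y + 1 + int h - 1) \<in> ?E \<or>
            domino (x + 1) (y + 1 + int h - 1) \<in> ?E"
          using rest h less unfolding resting_on_def by blast
        then show False using min[OF pred(2)] unfolding pred(1) by blast
            qed
      then show ?thesis using h by auto
    qed
    then have k': "k' \<ge> 1" using lk by (cases k') auto
    obtain ws where ws: "supported k' ws" "?E = stack_dominoes l' (y + 1) k' ws"
      using less.hyps[OF smaller rest conv lk k'] by blast
    have below: "\<exists>i<k. x - 1 = l + 2 * int i \<or> x = l + 2 * int i \<or> x + 1 = l + 2 * int i"
      if "x \<in> ?X" for x
    proof -
      have "domino (x - 1) y \<in> D \<or> domino x y \<in> D \<or> domino (x + 1) y \<in> D"
        using supp[of x "y + 1"] that by auto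
      then show ?thesis using base by (auto simp: mem_row_dominoes)
    qed
    \<comment> \<open>Support of the two outermost dominoes bounds the overhang on either
      side.\<close>
    have left: "l' \<in> ?X" unfolding lk using k' by (intro image_eqI[of _ _ 0]) auto
    have right: "l' + 2 * int (k' - 1) \<in> ?X" unfolding lk using k' by (intro imageI) auto
    from below[OF left] below[OF right] have "(k', l' - l) \<in> steps False False k"
      using k' by (auto simp: mem_steps)
    then have "supported k ((k', l' - l) # ws)"
      "D = stack_dominoes l y k ((k', l' - l) # ws)"
      using ws D_eq by auto
    then show ?thesis by blast
  qed
qed

section \<open>Rebuilding a tower from a stack\<close>

lemma domino_tower_place_row:
  assumes "domino_tower n b D" "row_dominoes l y k \<subseteq> D" "\<And>x y'. (x, y') \<in> \<Union>D \<Longrightarrow> y' \<le> y"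
    "(k', s) \<in> steps False False k" "k \<ge> 1" "j \<le> k'"
  shows "domino_tower (n + j) b (D \<union> row_dominoes (l + s) (y + 1) j)"
  using assms(6)
proof (induction j)
  case 0
  then show ?case using assms(1) by (simp add: row_dominoes_def)
next
  case (Suc j)
  let ?x = "l + s + 2 * int j"
  let ?D = "D \<union> row_dominoes (l + s) (y + 1) j"
  have "domino ?x (y + 1) \<inter> \<Union>?D = {}"
    using assms(3) unfolding Union_Un_distrib Union_row_dominoes
    by (fastforce simp: domino_def row_cells_def)
  moreover have "\<exists>i<k. ?x - 1 = l + 2 * int i \<or> ?x = l + 2 * int i \<or> ?x + 1 = l + 2 * int i"
  \<comment> \<open>Only the first domino can overhang on the left, and then the first domino below
    carries it. Otherwise the left cell of the new domino lies over the row below, and halving its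
    offset gives the index of a supporter.\<close>
  proof (cases "s + 2 * int j = -1")
    case True
    then show ?thesis using assms(5) by (intro exI[of _ 0]) auto
  next
    case False
    then have "0 \<le> s + 2 * int j" "s + 2 * int j \<le> 2 * int k - 1"
      using assms(4) Suc.prems by (auto simp: mem_steps)
    then show ?thesis
      by (intro exI[of _ "nat ((s + 2 * int j) div 2)"]) linarith
  qed
  then have "\<exists>x. (x = ?x - 1 \<or> x = ?x \<or> x = ?x + 1) \<and> domino x y \<in> row_dominoes l y k"
    unfolding mem_row_dominoes by blast
  then have "domino (?x - 1) y \<in> ?D \<or> domino ?x y \<in> ?D \<or> domino (?x + 1) y \<in> ?D"
    using assms(2) by blast
  ultimately have "domino_tower (Suc (n + j)) b (insert (domino ?x (y + 1)) ?D)"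
    using Suc by (intro domino_tower.place) auto
  moreover have "insert (domino ?x (y + 1)) ?D = D \<union> row_dominoes (l + s) (y + 1) (Suc j)"
    by (auto simp: row_dominoes_def lessThan_Suc)
  ultimately show ?case by simp
qed

lemma domino_tower_place_stack:
  assumes "domino_tower n b D" "row_dominoes l y k \<subseteq> D" "\<And>x y'. (x, y') \<in> \<Union>D \<Longrightarrow> y' \<le> y"
    "supported k ws" "k \<ge> 1"
  shows "domino_tower (n + sum_list (map fst ws)) b (D \<union> stack_dominoes l y k ws)"
  using assms
proof (induction k ws arbitrary: n D l y rule: supported.induct)
  case (1 k)
  then show ?case by (simp add: Un_absorb2)
next
  case (2 k k' s ws)
  have st: "(k', s) \<in> steps False False k" using 2 by simp
  let ?D = "D \<union> row_dominoes (l + s) (y + 1) k'"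
  have "domino_tower (n + k') b ?D"
    using domino_tower_place_row[OF 2(2,3,4) st 2(6)] by simp
  then have *: "domino_tower (n + k' + sum_list (map fst ws)) b
      (?D \<union> stack_dominoes (l + s) (y + 1) k' ws)"
  proof (rule 2(1))
    fix x y' assume "(x, y') \<in> \<Union>?D"
    then have "(x, y') \<in> \<Union>D \<or> (x, y') \<in> row_cells (l + s) (y + 1) k'"
      unfolding Union_Un_distrib Union_row_dominoes by blast
    then show "y' \<le> y + 1"
      using 2(4)[of x y'] by (elim disjE) (simp_all add: mem_row_cells del: Union_iff)
  qed (use 2 st in \<open>auto simp: mem_steps\<close>)
  have "row_dominoes (l + s) (y + 1) k' \<subseteq> stack_dominoes (l + s) (y + 1) k' ws"
    by (cases ws) auto
  then have "?D \<union> stack_dominoes (l + s) (y + 1) k' ws = D \<union> stack_dominoes l y k ((k', s) # ws)"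
    using 2(3) by auto
  then show ?case using * by (simp add: add.assoc)
qed

lemma domino_tower_stack:
  assumes "supported k ws" "k \<ge> 1"
  shows "domino_tower (k + sum_list (map fst ws)) k (stack_dominoes l y k ws)"
proof -
  have "domino_tower k k (row_dominoes l y k)"
    unfolding row_dominoes_def using assms(2) by (rule domino_tower.base)
  then have "domino_tower (k + sum_list (map fst ws)) k
      (row_dominoes l y k \<union> stack_dominoes l y k ws)"
    by (rule domino_tower_place_stack)
      (use assms in \<open>simp_all add: Union_row_dominoes mem_row_cells\<close>)
  moreover have "row_dominoes l y k \<subseteq> stack_dominoes l y k ws" by (cases ws) auto
  ultimately show ?thesis by (simp add: Un_absorb1)
qed

lemma convex_tower_iff_stack:
  "(\<exists>b. domino_tower n b D) \<and> convex_polyomino (\<Union>D) \<longleftrightarrow>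
   (\<exists>l y k ws. D = stack_dominoes l y k ws \<and> k \<ge> 1 \<and> profile False False k ws \<and>
      n = k + sum_list (map fst ws))"
proof
  assume *: "(\<exists>b. domino_tower n b D) \<and> convex_polyomino (\<Union>D)"
  then obtain b where "domino_tower n b D" by blast
  from domino_tower_resting_on[OF this] obtain x y where D: "card D = n" "b \<ge> 1"
    "resting_on y D" "{x'. domino x' y \<in> D} = (\<lambda>i. x + 2 * int i) ` {..<b}" by blast
  then obtain ws where ws: "supported b ws" "D = stack_dominoes x y b ws"
    using resting_on_imp_stack * by blast
  have "convex_polyomino (stack_cells x y b ws)"
    using * ws Union_stack_dominoes by simp
  then have "profile False False b ws"
    using convex_imp_profile[OF ws(1) D(2), of x y False False] by simp
  \<comment> \<open>Restacking the same dominoes produces a tower too, and both sizes equal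
    \<open>card D\<close>.\<close>
  moreover have "n = b + sum_list (map fst ws)"
    using domino_tower_resting_on[OF domino_tower_stack[OF ws(1) D(2)]] ws(2) D(1) by blast
  ultimately show "\<exists>l y k ws. D = stack_dominoes l y k ws \<and> k \<ge> 1 \<and> profile False False k ws \<and>
      n = k + sum_list (map fst ws)" using ws(2) D(2) by blast
next
  assume "\<exists>l y k ws. D = stack_dominoes l y k ws \<and> k \<ge> 1 \<and> profile False False k ws \<and>
      n = k + sum_list (map fst ws)"
  then show "(\<exists>b. domino_tower n b D) \<and> convex_polyomino (\<Union>D)"
    using domino_tower_stack profile_imp_supported profile_imp_convex Union_stack_dominoes
    by metis
qed

section \<open>Row lengths of a stack\<close>

lemma row_length_below: "y' < y \<Longrightarrow> row_length (stack_dominoes l y k ws) y' = 0"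
proof -
  assume "y' < y"
  then have "{x. domino x y' \<in> stack_dominoes l y k ws} = {}" using stack_dominoes_ge by fastforce
  then show ?thesis by (simp add: row_length_def)
qed

lemma row_length_row_dominoes: "row_length (row_dominoes l y k) y' = (if y' = y then k else 0)"
proof -
  have "{x. \<exists>i<k. x = l + 2 * int i} = (\<lambda>i. l + 2 * int i) ` {..<k}" by auto
  moreover have "inj_on (\<lambda>i. l + 2 * int i) {..<k}" by (simp add: inj_on_def)
  ultimately show ?thesis by (simp add: row_length_def mem_row_dominoes card_image)
qed

lemma range_row_length:
  "range (row_length (stack_dominoes l y k ws)) = insert 0 (set (k # map fst ws))"
proof (induction l y k ws rule: stack_dominoes.induct)
  case (1 l y k)
  have "row_length (row_dominoes l y k) (y + 1) = 0" "row_length (row_dominoes l y k) y = k"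
    by (simp_all add: row_length_row_dominoes)
  then have "{0, k} \<subseteq> range (row_length (row_dominoes l y k))"
    by (metis empty_subsetI insert_subset rangeI)
  then show ?case by (auto simp: row_length_row_dominoes)
next
  case (2 l y k k' s ws)
  let ?g = "row_length (stack_dominoes (l + s) (y + 1) k' ws)"
  let ?f = "row_length (stack_dominoes l y k ((k', s) # ws))"
  have f: "?f y' = (if y' = y then k else ?g y')" for y'
  proof (cases "y' = y")
    case True
    then have "\<And>x. domino x y' \<notin> stack_dominoes (l + s) (y + 1) k' ws"
      using stack_dominoes_ge by fastforce
    then have "?f y' = row_length (row_dominoes l y k) y'" by (simp add: row_length_def)
    then show ?thesis using True by (simp add: row_length_row_dominoes)
  next
    case False
    then show ?thesis by (simp add: row_length_def mem_row_dominoes)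
  qed
  \<comment> \<open>At height \<open>y\<close> the value 0 of \<open>?g\<close> is overwritten by
    \<open>k\<close>; height \<open>y - 1\<close> keeps 0 in the range.\<close>
  have "?g y = 0" "?g (y - 1) = 0" by (rule row_length_below; simp)+
  then have "range ?f = insert k (range ?g)"
    unfolding f by (auto simp: image_iff split: if_splits) (metis diff_add_cancel zero_neq_one add_cancel_right_right)+
  then show ?case using 2 by auto
qed

section \<open>Recovering a stack from its cells\<close>

lemma stack_cells_bottom: "(x, y) \<in> stack_cells l y k ws \<longleftrightarrow> l \<le> x \<and> x < l + 2 * int k"
proof (cases ws)
  case (Cons a ws')
  obtain k' s where "a = (k', s)" by fastforce
  moreover have "(x, y) \<notin> stack_cells (l + s) (y + 1) k' ws'" for s k'
    using stack_cells_ge by fastforce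
  ultimately show ?thesis using Cons by (simp add: mem_row_cells)
qed (simp add: mem_row_cells)

lemma stack_cells_above:
  "{c \<in> stack_cells l y k ws. y + 1 \<le> snd c} =
     (case ws of [] \<Rightarrow> {} | (k', s) # ws' \<Rightarrow> stack_cells (l + s) (y + 1) k' ws')"
proof (cases ws)
  case (Cons a ws')
  obtain k' s where a: "a = (k', s)" by fastforce
  have "\<And>x y'. (x, y') \<in> stack_cells (l + s) (y + 1) k' ws' \<Longrightarrow> y + 1 \<le> y'"
    by (rule stack_cells_ge)
  then show ?thesis by (auto simp: Cons a row_cells_def)
qed (auto simp: row_cells_def)

lemma stack_cells_eq_bottom:
  assumes "stack_cells l y k ws = stack_cells l2 y2 k2 ws2" "k \<ge> 1" "k2 \<ge> 1"
  shows "l = l2" "y = y2" "k = k2"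
proof -
  have "(l, y) \<in> stack_cells l y k ws" "(l2, y2) \<in> stack_cells l2 y2 k2 ws2"
    using assms(2,3) by (simp_all add: stack_cells_bottom)
  then have "(l, y) \<in> stack_cells l2 y2 k2 ws2" "(l2, y2) \<in> stack_cells l y k ws"
    using assms(1) by simp_all
  then show y: "y = y2" using stack_cells_ge by (meson order_antisym)
  have iff: "l \<le> x \<and> x < l + 2 * int k \<longleftrightarrow> l2 \<le> x \<and> x < l2 + 2 * int k2" for x
    using assms(1) y stack_cells_bottom by metis
  show "l = l2" using iff[of l] iff[of l2] assms(2,3) by auto
  then have "\<not> k < k2" "\<not> k2 < k"
    using iff[of "l + 2 * int k"] iff[of "l + 2 * int k2"] by auto
  then show "k = k2" by linarith
qed

text \<open>Polyominoes are compared as sets of cells, so the rows must be recoverable from these: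
  the lowest row is read off and removed, and the argument repeats.\<close>

lemma stack_cells_inject:
  assumes "stack_cells l y k ws = stack_cells l2 y2 k2 ws2"
    "k \<ge> 1" "supported k ws" "k2 \<ge> 1" "supported k2 ws2"
  shows "ws = ws2"
  using assms
proof (induction k ws arbitrary: l y l2 y2 k2 ws2 rule: supported.induct)
  case (1 k)
  have eq: "l = l2" "y = y2" "k = k2" using stack_cells_eq_bottom[OF 1(1,2,4)] by simp_all
  show ?case
  proof (cases ws2)
    case (Cons a ws')
    obtain k' s where a: "a = (k', s)" by fastforce
    have "(l + s, y + 1) \<in> stack_cells (l + s) (y + 1) k' ws'"
      using 1 Cons a by (auto simp: stack_cells_bottom mem_steps)
    then have "(l + s, y + 1) \<in> stack_cells l2 y2 k2 ws2" using Cons a eq by simp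
    then show ?thesis using 1(1)[symmetric] by (simp add: mem_row_cells)
  qed simp
next
  case (2 k k' s ws)
  have eq: "l = l2" "y = y2" "k = k2" using stack_cells_eq_bottom[OF 2(2,3,5)] by simp_all
  have k': "k' \<ge> 1" using 2 by (simp add: mem_steps)
  have "(l + s, y + 1) \<in> stack_cells (l + s) (y + 1) k' ws"
    using k' by (simp add: stack_cells_bottom)
  then have "(l + s, y + 1) \<in> stack_cells l2 y2 k2 ws2" using 2(2) by auto
  then obtain k2' s2 ws2' where ws2: "ws2 = (k2', s2) # ws2'"
    using eq by (cases ws2) (auto simp: mem_row_cells)
  have S: "stack_cells l y k ((k', s) # ws) = stack_cells l y k ws2" using 2(2) unfolding eq .
  have *: "stack_cells (l + s) (y + 1) k' ws = stack_cells (l + s2) (y + 1) k2' ws2'"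
    using stack_cells_above[of l y k "(k', s) # ws"] stack_cells_above[of l y k ws2] unfolding S
    by (simp add: ws2 del: stack_cells.simps)
  have k2': "k2' \<ge> 1" using 2 ws2 by (simp add: mem_steps)
  show ?case
    using stack_cells_eq_bottom[OF * k' k2'] 2(1)[OF * k' _ k2'] 2 ws2 by auto
qed

subsection \<open>Counting up to translation\<close>

definition reaches :: "nat \<Rightarrow> nat \<Rightarrow> (nat \<times> int) list \<Rightarrow> bool" where
  "reaches b k ws \<longleftrightarrow> b \<in> set (k # map fst ws) \<and> (\<forall>j\<in>set (k # map fst ws). j \<le> b)"

definition tower_profiles :: "nat \<Rightarrow> nat \<Rightarrow> (nat \<times> (nat \<times> int) list) set" where
  "tower_profiles b n = {(k, ws). 1 \<le> k \<and> profile False False k ws \<and> reaches b k ws \<and>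
     k + sum_list (map fst ws) = n}"

lemma Max_row_length:
  assumes "b \<ge> 1"
  shows "Max (range (row_length (stack_dominoes l y k ws))) = b \<longleftrightarrow> reaches b k ws"
proof -
  have "Max (insert 0 (set (k # map fst ws))) = b \<longleftrightarrow>
      b \<in> insert 0 (set (k # map fst ws)) \<and> (\<forall>j\<in>insert 0 (set (k # map fst ws)). j \<le> b)"
    by (rule Max_eq_iff) auto
  then show ?thesis
    unfolding range_row_length reaches_def using assms by auto
qed

lemma convex_tower_polyominoes_eq:
  assumes "b \<ge> 1"
  shows "convex_tower_polyominoes b n =
    {stack_cells l y k ws |l y k ws. (k, ws) \<in> tower_profiles b n}"
proof -
  have "convex_tower_polyominoes b n = {\<Union>D |D. (\<exists>l y k ws. D = stack_dominoes l y k ws \<and> k \<ge> 1 \<and>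
      profile False False k ws \<and> n = k + sum_list (map fst ws)) \<and> Max (range (row_length D)) = b}"
    unfolding convex_tower_polyominoes_def conj_assoc[symmetric] convex_tower_iff_stack ..
  also have "\<dots> = {\<Union>(stack_dominoes l y k ws) |l y k ws. k \<ge> 1 \<and> profile False False k ws \<and>
      n = k + sum_list (map fst ws) \<and> Max (range (row_length (stack_dominoes l y k ws))) = b}"
    by blast
  also have "\<dots> = {stack_cells l y k ws |l y k ws. (k, ws) \<in> tower_profiles b n}"
    unfolding Max_row_length[OF assms] Union_stack_dominoes tower_profiles_def by auto
  finally show ?thesis .
qed

lemma mem_translate_stack_cells:
  "(a - u, b - v) \<in> stack_cells l y k ws \<longleftrightarrow> (a, b) \<in> stack_cells (l + u) (y + v) k ws"
  by (induction l y k ws rule: stack_cells.induct) (auto simp: mem_row_cells algebra_simps)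

lemma translate_stack_cells:
  "(\<lambda>(x, y). (x + u, y + v)) ` stack_cells l y k ws = stack_cells (l + u) (y + v) k ws"
proof (rule set_eqI, clarify)
  fix a b
  have image: "(a, b) \<in> (\<lambda>(x, y). (x + u, y + v)) ` S \<longleftrightarrow> (a - u, b - v) \<in> S" for S
    by (auto simp: image_iff intro: bexI[of _ "(a - u, b - v)"])
  show "(a, b) \<in> (\<lambda>(x, y). (x + u, y + v)) ` stack_cells l y k ws \<longleftrightarrow>
      (a, b) \<in> stack_cells (l + u) (y + v) k ws"
    unfolding image by (rule mem_translate_stack_cells)
qed

lemma translation_class_stack_cells:
  "translation_rel `` {stack_cells l y k ws} = range (\<lambda>(u, v). stack_cells u v k ws)"
proof -
  have "translation_rel `` {stack_cells l y k ws} =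
      {(\<lambda>(x, y). (x + u, y + v)) ` stack_cells l y k ws |u v. True}"
    by (auto simp: translation_rel_def)
  also have "\<dots> = range (\<lambda>(u, v). stack_cells (l + u) (y + v) k ws)"
    unfolding translate_stack_cells by auto
  also have "\<dots> = range (\<lambda>(u, v). stack_cells u v k ws)"
  proof (intro equalityI subsetI; clarify)
    fix u v
    show "stack_cells (l + u) (y + v) k ws \<in> range (\<lambda>(u, v). stack_cells u v k ws)"
      by (rule range_eqI[of _ _ "(l + u, y + v)"]) simp
    show "stack_cells u v k ws \<in> range (\<lambda>(u, v). stack_cells (l + u) (y + v) k ws)"
      by (rule range_eqI[of _ _ "(u - l, v - y)"]) simp
  qed
  finally show ?thesis .
qed

text \<open>A translation class consists of all placements of one profile, and any single placement
  determines the profile.\<close>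

lemma num_convex_towers_eq_card:
  assumes "b \<ge> 1"
  shows "num_convex_towers b n = card (tower_profiles b n)"
proof -
  let ?f = "\<lambda>(k, ws). range (\<lambda>(u, v). stack_cells u v k ws)"
  have "convex_tower_polyominoes b n // translation_rel =
      {translation_rel `` {stack_cells l y k ws} |l y k ws. (k, ws) \<in> tower_profiles b n}"
    unfolding quotient_def convex_tower_polyominoes_eq[OF assms] by blast
  also have "\<dots> = ?f ` tower_profiles b n"
    unfolding translation_class_stack_cells by auto
  finally have "convex_tower_polyominoes b n // translation_rel = ?f ` tower_profiles b n" .
  moreover have "inj_on ?f (tower_profiles b n)"
  proof (rule inj_onI, clarify)
    fix k ws k2 ws2
    assume *: "(k, ws) \<in> tower_profiles b n" "(k2, ws2) \<in> tower_profiles b n"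
      "range (\<lambda>(u, v). stack_cells u v k ws) = range (\<lambda>(u, v). stack_cells u v k2 ws2)"
    have "stack_cells 0 0 k ws \<in> range (\<lambda>(u, v). stack_cells u v k ws)"
      by (rule range_eqI[of _ _ "(0, 0)"]) simp
    then obtain u v where "stack_cells 0 0 k ws = stack_cells u v k2 ws2" unfolding *(3) by auto
    note eq = this
    have wf: "k \<ge> 1" "supported k ws" "k2 \<ge> 1" "supported k2 ws2"
      using *(1,2) profile_imp_supported by (auto simp: tower_profiles_def)
    show "k = k2 \<and> ws = ws2"
      using stack_cells_eq_bottom(3)[OF eq wf(1,3)] stack_cells_inject[OF eq wf] by simp
  qed
  ultimately show ?thesis by (simp add: num_convex_towers_def card_image)
qed

section \<open>Recursion for the number of profiles\<close>

definition profile_count ::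
  "bool \<Rightarrow> bool \<Rightarrow> nat \<Rightarrow> ((nat \<times> int) list \<Rightarrow> bool) \<Rightarrow> nat \<Rightarrow> nat" where
  "profile_count lf rf k Q n = card {ws. profile lf rf k ws \<and> Q ws \<and> sum_list (map fst ws) = n}"

lemma profile_set_step:
  "{ws. profile lf rf k ws \<and> Q ws \<and> sum_list (map fst ws) = n} =
     (if n = 0 \<and> Q [] then {[]} else {}) \<union>
     (\<Union>p\<in>{p \<in> steps lf rf k. fst p \<le> n}. Cons p `
        {ws. profile (lf \<or> 0 < snd p) (rf \<or> snd p + 2 * int (fst p) < 2 * int k) (fst p) ws \<and>
           Q (p # ws) \<and> sum_list (map fst ws) = n - fst p})" (is "?L = ?R")
proof (rule set_eqI)
  fix ws
  show "ws \<in> ?L \<longleftrightarrow> ws \<in> ?R"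
  proof (cases ws)
    case (Cons p ws')
    have mem: "p # ws' \<in> Cons q ` A \<longleftrightarrow> q = p \<and> ws' \<in> A" for q A by auto
    show ?thesis unfolding Cons Un_iff UN_iff mem by (cases p) auto
  qed auto
qed

lemma finite_steps: "finite (steps lf rf k)"
  unfolding steps_def by (intro finite_SigmaI) auto

lemma finite_profiles: "finite {ws. profile lf rf k ws \<and> Q ws \<and> sum_list (map fst ws) = n}"
proof (induction n arbitrary: lf rf k Q rule: less_induct)
  case (less n)
  show ?case
    unfolding profile_set_step[of lf rf k Q n]
  proof (intro finite_UnI finite_UN_I finite_imageI)
    fix p assume "p \<in> {p \<in> steps lf rf k. fst p \<le> n}"
    then have "n - fst p < n" by (cases p) (auto simp: mem_steps)
    then show "finite {ws. profile (lf \<or> 0 < snd p) (rf \<or> snd p + 2 * int (fst p) < 2 * int k) (fst p) ws \<and>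
           Q (p # ws) \<and> sum_list (map fst ws) = n - fst p}" by (rule less)
  qed (auto simp: finite_steps)
qed

lemma profile_count_step:
  assumes "n \<ge> 1"
  shows "profile_count lf rf k Q n =
    (\<Sum>(k', s)\<in>{p \<in> steps lf rf k. fst p \<le> n}.
       profile_count (lf \<or> 0 < s) (rf \<or> s + 2 * int k' < 2 * int k) k'
         (\<lambda>ws. Q ((k', s) # ws)) (n - k'))"
proof -
  let ?P = "{p \<in> steps lf rf k. fst p \<le> n}"
  let ?A = "\<lambda>p. {ws. profile (lf \<or> 0 < snd p) (rf \<or> snd p + 2 * int (fst p) < 2 * int k) (fst p) ws \<and>
           Q (p # ws) \<and> sum_list (map fst ws) = n - fst p}"
  have "profile_count lf rf k Q n = card (\<Union>p\<in>?P. Cons p ` ?A p)"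
    unfolding profile_count_def profile_set_step[of lf rf k Q n] using assms by simp
  also have "\<dots> = (\<Sum>p\<in>?P. card (Cons p ` ?A p))"
  proof (rule card_UN_disjoint)
    show "finite ?P" using finite_steps by simp
    show "\<forall>p\<in>?P. finite (Cons p ` ?A p)" by (intro ballI finite_imageI finite_profiles)
    show "\<forall>p\<in>?P. \<forall>q\<in>?P. p \<noteq> q \<longrightarrow> Cons p ` ?A p \<inter> Cons q ` ?A q = {}" by blast
  qed
  also have "\<dots> = (\<Sum>p\<in>?P. profile_count (lf \<or> 0 < snd p)
       (rf \<or> snd p + 2 * int (fst p) < 2 * int k) (fst p) (\<lambda>ws. Q (p # ws)) (n - fst p))"
    by (simp add: card_image profile_count_def)
  finally show ?thesis by (simp add: case_prod_beta)
qed

text \<open>Widening a row requires both ends to move outwards, which a single flag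
  prevents.\<close>

lemma profile_fst_le:
  assumes "profile lf rf k ws" "lf \<or> rf" "j \<in> set (map fst ws)"
  shows "j \<le> k"
  using assms
  by (induction lf rf k ws rule: profile.induct) (fastforce simp: mem_steps)+

lemma profile_count_0: "profile_count lf rf k Q 0 = (if Q [] then 1 else 0)"
proof -
  have *: "{p \<in> steps lf rf k. fst p \<le> 0} = {}" by (auto simp: mem_steps)
  show ?thesis unfolding profile_count_def profile_set_step[of lf rf k Q 0] * by simp
qed

lemma profile_count_mirror:
  "profile_count lf rf k (\<lambda>_. True) n = profile_count rf lf k (\<lambda>_. True) n"
proof (induction n arbitrary: lf rf k rule: less_induct)
  case (less n)
  show ?case
  proof (cases "n = 0")
    case False
    then have n: "n \<ge> 1" by simp
    \<comment> \<open>When the left end moves right by \<open>s\<close>, the right end moves left by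
      \<open>2 * int k - 2 * int k' - s\<close>; reflection exchanges the two.\<close>
    let ?i = "\<lambda>(k', s). (k', 2 * int k - 2 * int k' - s)"
    show ?thesis
      unfolding profile_count_step[OF n]
    proof (rule sum.reindex_bij_witness[of _ ?i ?i], goal_cases)
      case (5 p)
      obtain k' s where p: "p = (k', s)" by fastforce
      with 5 have "n - k' < n" by (auto simp: mem_steps)
      have "s < 2 * int k - 2 * int k' \<longleftrightarrow> s + 2 * int k' < 2 * int k" by auto
      with less[OF \<open>n - k' < n\<close>] show ?case by (simp add: p)
    qed (auto simp: mem_steps)
  qed (simp add: profile_count_0)
qed

subsection \<open>Linear recurrences and the infinite product\<close>

lemma linear_recurrence_tendsto_zero:
  fixes v e :: "nat \<Rightarrow> real"
  assumes "e \<longlonglongrightarrow> 0" "\<bar>q\<bar> < 1" "k \<ge> 1"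
    "\<And>n. n \<ge> N \<Longrightarrow> v n = q * v (n - k) + e n"
  shows "v \<longlonglongrightarrow> 0"
proof (rule LIMSEQ_I)
  fix r :: real assume "r > 0"
  \<comment> \<open>Chosen so that \<open>\<bar>q\<bar> * (r / 2) + \<epsilon> = r / 2\<close>: the
    constant part of the bound below reproduces itself.\<close>
  define \<epsilon> where "\<epsilon> = r / 2 * (1 - \<bar>q\<bar>)"
  have "\<epsilon> > 0" using \<open>r > 0\<close> assms(2) by (simp add: \<epsilon>_def)
  then obtain N1 where N1: "\<And>n. n \<ge> N1 \<Longrightarrow> \<bar>e n\<bar> < \<epsilon>"
    using assms(1) by (metis LIMSEQ_D diff_zero real_norm_def)
  define M0 where "M0 = N + N1 + k"
  define B where "B = (\<Sum>i<M0 + k. \<bar>v i\<bar>)"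
  have B: "\<bar>v n\<bar> \<le> B" if "n < M0 + k" for n
    unfolding B_def using that by (intro member_le_sum) auto
  have "B \<ge> 0" unfolding B_def by (intro sum_nonneg) auto
  \<comment> \<open>The exponent counts full steps of length \<open>k\<close> beyond
    \<open>M0\<close>; \<open>B\<close> covers the first block.\<close>
  have bound: "\<bar>v (M0 + n)\<bar> \<le> \<bar>q\<bar> ^ (n div k) * B + r / 2" for n
  proof (induction n rule: less_induct)
    case (less n)
    show ?case
    proof (cases "n < k")
      case True
      then show ?thesis using B[of "M0 + n"] \<open>r > 0\<close> by simp
    next
      case False
      have "\<bar>v (M0 + n)\<bar> = \<bar>q * v (M0 + (n - k)) + e (M0 + n)\<bar>"
        using assms(4)[of "M0 + n"] False by (simp add: M0_def)
      also have "\<dots> \<le> \<bar>q\<bar> * \<bar>v (M0 + (n - k))\<bar> + \<bar>e (M0 + n)\<bar>"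
        by (metis abs_mult abs_triangle_ineq)
      also have "\<dots> \<le> \<bar>q\<bar> * (\<bar>q\<bar> ^ ((n - k) div k) * B + r / 2) + \<epsilon>"
        using less[of "n - k"] False assms(3) N1[of "M0 + n"]
        by (intro add_mono mult_left_mono) (auto simp: M0_def)
      also have "\<dots> = \<bar>q\<bar> ^ Suc ((n - k) div k) * B + r / 2"
        by (simp add: \<epsilon>_def field_simps)
      also have "Suc ((n - k) div k) = n div k" using False assms(3) by (simp add: le_div_geq)
      finally show ?thesis .
    qed
  qed
  have "(\<lambda>j. \<bar>q\<bar> ^ j * B) \<longlonglongrightarrow> 0 * B"
    using assms(2) by (intro tendsto_mult LIMSEQ_realpow_zero) auto
  then have "\<forall>\<^sub>F j in sequentially. \<bar>q\<bar> ^ j * B < r / 2"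
    using \<open>r > 0\<close> by (intro order_tendstoD(2)[of _ 0]) auto
  then obtain J where J: "\<And>j. j \<ge> J \<Longrightarrow> \<bar>q\<bar> ^ j * B < r / 2"
    unfolding eventually_sequentially by blast
  have "norm (v n - 0) < r" if "n \<ge> M0 + J * k" for n
  proof -
    have "J \<le> (n - M0) div k" using that assms(3) by (simp add: less_eq_div_iff_mult_less_eq)
    then show ?thesis using bound[of "n - M0"] J[of "(n - M0) div k"] that by simp
  qed
  then show "\<exists>n0. \<forall>n\<ge>n0. norm (v n - 0) < r" by blast
qed

text \<open>Subtracting the fixed point \<open>\<delta> / (1 - q)\<close> leaves a recurrence whose
  inhomogeneous term tends to 0.\<close>

lemma linear_recurrence_tendsto:
  fixes u d :: "nat \<Rightarrow> real"
  assumes "d \<longlonglongrightarrow> \<delta>" "\<bar>q\<bar> < 1" "k \<ge> 1"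
    "\<And>n. n \<ge> N \<Longrightarrow> u n = q * u (n - k) + d n"
  shows "u \<longlonglongrightarrow> \<delta> / (1 - q)"
proof -
  have "(\<lambda>n. u n - \<delta> / (1 - q)) \<longlonglongrightarrow> 0"
  proof (rule linear_recurrence_tendsto_zero)
    show "(\<lambda>n. d n - \<delta>) \<longlonglongrightarrow> 0" using assms(1) by (simp add: LIM_zero)
    fix n assume "n \<ge> N"
    moreover have "1 - q \<noteq> 0" using assms(2) by auto
    ultimately show "u n - \<delta> / (1 - q) = q * (u (n - k) - \<delta> / (1 - q)) + (d n - \<delta>)"
      using assms(4) by (simp add: field_simps)
  qed (use assms in auto)
  then show ?thesis using LIM_zero_cancel by blast
qed

section \<open>The partial products, the ascent factor and the numerical value of the
  product\<close>

definition partial_P :: "nat \<Rightarrow> real" where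
  "partial_P b = (\<Prod>k = 1..<b. 2 ^ k / (2 ^ k - 1))"

lemma partial_P_1 [simp]: "partial_P (Suc 0) = 1"
  by (simp add: partial_P_def)

lemma partial_P_Suc: "b \<ge> 1 \<Longrightarrow> partial_P (Suc b) = partial_P b * (2 ^ b / (2 ^ b - 1))"
  by (simp add: partial_P_def)

lemma partial_P_pos: "partial_P b > 0"
  unfolding partial_P_def by (intro prod_pos) (auto simp: one_less_power)

text \<open>Telescopes, because \<open>partial_P (Suc k) * (1 - 1 / 2 ^ k) = partial_P k\<close>.
  The sum is the contribution of shorter rows when exactly one end has retreated.\<close>

lemma sum_partial_P:
  assumes "k \<ge> 1"
  shows "(\<Sum>j = 1..<k. 2 * partial_P j / 2 ^ j) = partial_P k * (1 - 2 / 2 ^ k)"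
  using assms
proof (induction k rule: dec_induct)
  case (step n)
  have "(2::real) ^ n \<noteq> 1" using step one_less_power[of "2::real" n] by fastforce
  then show ?case using step by (simp add: partial_P_Suc field_simps)
qed simp

text \<open>The factor \<open>H\<^sub>b\<close> above.\<close>

definition ascent_factor :: "nat \<Rightarrow> real" where
  "ascent_factor b = (\<Sum>k = 1..b. \<Prod>j = k..<b. 1 / (2 ^ j - 1))"

lemma ascent_factor_1 [simp]: "ascent_factor (Suc 0) = 1"
  by (simp add: ascent_factor_def)

lemma ascent_factor_Suc:
  assumes "b \<ge> 1"
  shows "ascent_factor (Suc b) = 1 + ascent_factor b / (2 ^ b - 1)"
proof -
  have "(\<Sum>k = 1..b. \<Prod>j = k..<Suc b. 1 / (2 ^ j - 1 :: real)) =
      (\<Sum>k = 1..b. (\<Prod>j = k..<b. 1 / (2 ^ j - 1)) * (1 / (2 ^ b - 1)))"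
    by (intro sum.cong) auto
  then show ?thesis by (simp add: ascent_factor_def sum_divide_distrib)
qed

lemma ascent_factor_bounds: "b \<ge> 1 \<Longrightarrow> 1 \<le> ascent_factor b \<and> ascent_factor b \<le> 2"
proof (induction b rule: dec_induct)
  case (step n)
  show ?case
  \<comment> \<open>For \<open>n = 1\<close> the denominator \<open>2 ^ n - 1\<close> is 1 and the
    successor attains the bound 2; from \<open>n = 2\<close> on it is at least 3.\<close>
  proof (cases "n = 1")
    case False
    then have "n \<ge> 2" using step by simp
    then have "(2::real) ^ 2 \<le> 2 ^ n" by (intro power_increasing) auto
    then have "ascent_factor n \<le> 2 ^ n - 1" "0 < (2::real) ^ n - 1" using step by auto
    then show ?thesis using step by (simp add: ascent_factor_Suc divide_le_eq)
  qed (simp add: ascent_factor_Suc)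
qed simp

lemma ascent_factor_tendsto: "ascent_factor \<longlonglongrightarrow> 1"
proof (rule LIMSEQ_imp_Suc, rule tendsto_sandwich)
  show "\<forall>\<^sub>F b in sequentially. 1 \<le> ascent_factor (Suc b)"
    using ascent_factor_bounds by (intro always_eventually) auto
  have "ascent_factor (Suc b) \<le> 1 + 2 / (2 ^ b - 1)" if "b \<ge> 1" for b
    unfolding ascent_factor_Suc[OF that] using ascent_factor_bounds[OF that]
    by (intro add_left_mono divide_right_mono) auto
  then show "\<forall>\<^sub>F b in sequentially. ascent_factor (Suc b) \<le> 1 + 2 / (2 ^ b - 1)"
    using eventually_sequentially by blast
  show "(\<lambda>b. 1 + 2 / (2 ^ b - 1) :: real) \<longlonglongrightarrow> 1" by real_asymp
qed simp

text \<open>Each factor is \<open>1 + 1 / (2 ^ Suc k - 1)\<close>, and the excess over 1 is at most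
  \<open>(1 / 2) ^ k\<close>.\<close>

lemma convergent_prod_P: "convergent_prod (\<lambda>k. 2 ^ Suc k / (2 ^ Suc k - 1) :: real)"
proof -
  have "summable (\<lambda>k. norm (1 / (2 ^ Suc k - 1) :: real))"
  proof (rule summable_comparison_test')
    show "summable (\<lambda>k. (1 / 2) ^ k :: real)" by simp
    fix k :: nat
    have "(1::real) \<le> 2 ^ k" by simp
    then have "0 < (2::real) ^ k" "(2::real) ^ k \<le> 2 ^ Suc k - 1" by auto
    then have "1 / (2 ^ Suc k - 1) \<le> 1 / (2::real) ^ k" by (intro frac_le) auto
    moreover have "0 < (2::real) ^ Suc k - 1" using one_less_power[of "2::real" "Suc k"] by linarith
    ultimately show "norm (norm (1 / (2 ^ Suc k - 1) :: real)) \<le> (1 / 2) ^ k"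
      by (simp add: power_one_over del: power_Suc)
  qed
  then have "abs_convergent_prod (\<lambda>k. 1 + 1 / (2 ^ Suc k - 1) :: real)"
    by (intro summable_imp_abs_convergent_prod) simp
  then have "convergent_prod (\<lambda>k. 1 + 1 / (2 ^ Suc k - 1) :: real)"
    by (rule abs_convergent_prod_imp_convergent_prod)
  moreover have "1 + 1 / (2 ^ Suc k - 1) = 2 ^ Suc k / (2 ^ Suc k - 1 :: real)" for k
  proof -
    have "(1::real) < 2 ^ Suc k" by (rule one_less_power) auto
    then show ?thesis by (simp add: field_simps)
  qed
  ultimately show ?thesis by simp
qed

lemma partial_P_tendsto: "partial_P \<longlonglongrightarrow> tower_P"
proof -
  have "(\<lambda>n. \<Prod>i\<le>n. 2 ^ Suc i / (2 ^ Suc i - 1) :: real) \<longlonglongrightarrow> tower_P"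
    unfolding tower_P_def by (rule convergent_prod_LIMSEQ[OF convergent_prod_P])
  \<comment> \<open>The index \<open>i\<close> starts at 0 and includes \<open>n\<close>, while
    \<open>partial_P\<close> starts at 1 and omits its bound; hence the shift by two.\<close>
  moreover have "(\<Prod>i\<le>n. 2 ^ Suc i / (2 ^ Suc i - 1) :: real) = partial_P (Suc (Suc n))" for n
    unfolding partial_P_def
    by (rule prod.reindex_bij_witness[of _ "\<lambda>k. k - 1" Suc]) auto
  ultimately have "(\<lambda>n. partial_P (Suc (Suc n))) \<longlonglongrightarrow> tower_P" by simp
  then show ?thesis by (rule LIMSEQ_imp_Suc[OF LIMSEQ_imp_Suc])
qed

text \<open>The tail of the product is controlled by \<open>\<Prod>(1 - x\<^sub>k) \<ge> 1 - \<Sum>x\<^sub>k\<close>.\<close>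

lemma partial_P_add_le:
  assumes "N \<ge> 1"
  shows "partial_P (N + m) * (1 - 2 / 2 ^ N + 2 / 2 ^ (N + m)) \<le> partial_P N"
proof (induction m)
  case (Suc m)
  \<comment> \<open>The new factor is \<open>1 / (1 - x)\<close>, and the brackets for
    \<open>m\<close> and \<open>Suc m\<close> are \<open>c + 2 * x\<close> and
    \<open>c + x\<close>.\<close>
  define x where "x = 1 / (2::real) ^ (N + m)"
  define c where "c = 1 - 2 / (2::real) ^ N"
  have c: "0 \<le> c" using assms by (cases N) (simp_all add: c_def)
  have "(2::real) ^ 1 \<le> 2 ^ (N + m)" using assms by (intro power_increasing) auto
  then have "x \<le> 1 / 2" "0 < x"
    by (simp_all add: x_def field_simps)
  have c1: "c + 2 * x \<le> 1"
    by (simp add: c_def x_def power_add frac_le)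
  have "partial_P (N + Suc m) = partial_P (N + m) / (1 - x)"
    using partial_P_Suc[of "N + m"] assms \<open>x \<le> 1 / 2\<close> by (simp add: x_def field_simps)
  moreover have "(c + x) \<le> (c + 2 * x) * (1 - x)"
  proof -
    have "x * (c + 2 * x) \<le> x * 1" using c1 \<open>0 < x\<close> by (intro mult_left_mono) auto
    then show ?thesis by (simp add: algebra_simps)
  qed
  then have "(c + x) / (1 - x) \<le> c + 2 * x" using \<open>x \<le> 1 / 2\<close> by (simp add: divide_le_eq)
  then have "partial_P (N + m) * ((c + x) / (1 - x)) \<le> partial_P (N + m) * (c + 2 * x)"
    using partial_P_pos by (intro mult_left_mono) (auto simp: less_imp_le)
  ultimately have "partial_P (N + Suc m) * (c + x) \<le> partial_P (N + m) * (c + 2 * x)" by simp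
  then show ?case using Suc by (simp add: x_def c_def)
qed simp

lemma tower_P_bounds:
  assumes "N \<ge> 1"
  shows "partial_P N \<le> tower_P" "tower_P * (1 - 2 / 2 ^ N) \<le> partial_P N"
proof -
  have "incseq (\<lambda>n. partial_P (n + N))"
  proof (rule incseq_SucI)
    fix n
    have "(1::real) < 2 ^ (n + N)" using assms by (intro one_less_power) auto
    then have "1 \<le> (2::real) ^ (n + N) / (2 ^ (n + N) - 1)" by simp
    then have "partial_P (n + N) * 1 \<le> partial_P (n + N) * (2 ^ (n + N) / (2 ^ (n + N) - 1))"
      using partial_P_pos by (intro mult_left_mono) (auto simp: less_imp_le)
    then show "partial_P (n + N) \<le> partial_P (Suc n + N)" using partial_P_Suc[of "n + N"] assms by simp
  qed
  then show "partial_P N \<le> tower_P"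
    using incseq_le[of _ tower_P 0] LIMSEQ_ignore_initial_segment[OF partial_P_tendsto] by fastforce
  have "partial_P (m + N) * (1 - 2 / 2 ^ N) \<le> partial_P N" for m
  proof -
    have "partial_P (m + N) * (1 - 2 / 2 ^ N) \<le> partial_P (N + m) * (1 - 2 / 2 ^ N + 2 / 2 ^ (N + m))"
      using partial_P_pos[of "N + m"] by (simp add: add.commute)
    then show ?thesis using partial_P_add_le[OF assms, of m] by linarith
  qed
  then show "tower_P * (1 - 2 / 2 ^ N) \<le> partial_P N"
    using LIMSEQ_ignore_initial_segment[OF partial_P_tendsto, of N]
    by (intro LIMSEQ_le_const2[OF tendsto_mult_right]) auto
qed

text \<open>Eleven factors suffice: \<open>tower_P\<close> lies between \<open>partial_P 12\<close>
  and \<open>partial_P 12 / (1 - 2 / 2 ^ 12)\<close>, well inside the rounding interval from 3.455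
  to 3.465.\<close>

lemma round_tower_P: "round (100 * tower_P) = 346"
proof -
  have "{1..<12} = {1, 2, 3, 4, 5, 6, 7, 8, 9, 10, 11::nat}"
    by (intro set_eqI) (simp, presburger)
  then have P: "partial_P 12 = 2^1/(2^1-1) * (2^2/(2^2-1)) * (2^3/(2^3-1)) * (2^4/(2^4-1)) *
      (2^5/(2^5-1)) * (2^6/(2^6-1)) * (2^7/(2^7-1)) * (2^8/(2^8-1)) * (2^9/(2^9-1)) *
      (2^10/(2^10-1)) * (2^11/(2^11-1))"
    unfolding partial_P_def by simp
  have "3.455 < tower_P" using tower_P_bounds(1)[of 12] unfolding P by simp
  moreover have "tower_P < 3.465" using tower_P_bounds(2)[of 12] unfolding P by simp
  ultimately show ?thesis by (simp add: round_def floor_eq_iff)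
qed

subsection \<open>Limiting densities\<close>

definition profile_density ::
  "bool \<Rightarrow> bool \<Rightarrow> nat \<Rightarrow> ((nat \<times> int) list \<Rightarrow> bool) \<Rightarrow> nat \<Rightarrow> real" where
  "profile_density lf rf k Q n = real (profile_count lf rf k Q n) / 2 ^ n"

text \<open>Intended for states with a retreated end; \<open>profile_density_flagged\<close> shows
  these values to be the limits.\<close>

definition limit_density :: "bool \<Rightarrow> bool \<Rightarrow> nat \<Rightarrow> real" where
  "limit_density lf rf k = (if lf \<and> rf then 0 else partial_P k)"

text \<open>Once every possible next row fits into \<open>n\<close>, the index set no longer depends
  on \<open>n\<close>, and the recurrence has constant coefficients.\<close>

lemma profile_density_step:
  assumes "n \<ge> 1" "\<And>p. p \<in> steps lf rf k \<Longrightarrow> fst p \<le> n"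
  shows "profile_density lf rf k Q n =
    (\<Sum>(k', s)\<in>steps lf rf k. profile_density (lf \<or> 0 < s) (rf \<or> s + 2 * int k' < 2 * int k) k'
       (\<lambda>ws. Q ((k', s) # ws)) (n - k') / 2 ^ k')"
proof -
  have "{p \<in> steps lf rf k. fst p \<le> n} = steps lf rf k" using assms(2) by auto
  then have "profile_density lf rf k Q n =
    (\<Sum>(k', s)\<in>steps lf rf k. real (profile_count (lf \<or> 0 < s) (rf \<or> s + 2 * int k' < 2 * int k) k'
       (\<lambda>ws. Q ((k', s) # ws)) (n - k')) / 2 ^ n)"
    unfolding profile_density_def profile_count_step[OF assms(1)]
    by (simp add: sum_divide_distrib case_prod_beta)
  also have "\<dots> = (\<Sum>(k', s)\<in>steps lf rf k. profile_density (lf \<or> 0 < s) (rf \<or> s + 2 * int k' < 2 * int k) k'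
       (\<lambda>ws. Q ((k', s) # ws)) (n - k') / 2 ^ k')"
  proof (intro sum.cong refl, clarify)
    fix k' s assume "(k', s) \<in> steps lf rf k"
    then have "(2::real) ^ n = 2 ^ (n - k') * 2 ^ k'"
      using assms(2) by (fastforce simp flip: power_add)
    then show "real (profile_count (lf \<or> 0 < s) (rf \<or> s + 2 * int k' < 2 * int k) k'
       (\<lambda>ws. Q ((k', s) # ws)) (n - k')) / 2 ^ n = profile_density (lf \<or> 0 < s) (rf \<or> s + 2 * int k' < 2 * int k) k'
       (\<lambda>ws. Q ((k', s) # ws)) (n - k') / 2 ^ k'"
      by (simp add: profile_density_def)
  qed
  finally show ?thesis .
qed

text \<open>Steps in \<open>K\<close> keep the state, those in \<open>A\<close> lead to states whose limiting density is known.\<close>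

lemma profile_density_tendsto:
  assumes "steps lf rf k = K \<union> A" "K \<inter> A = {}" "real (card K) < 2 ^ k" "k \<ge> 1"
    "\<And>k' s n. (k', s) \<in> K \<Longrightarrow> profile_density (lf \<or> 0 < s) (rf \<or> s + 2 * int k' < 2 * int k) k'
       (\<lambda>ws. Q ((k', s) # ws)) n = profile_density lf rf k Q n \<and> k' = k"
    "\<And>k' s. (k', s) \<in> A \<Longrightarrow> profile_density (lf \<or> 0 < s) (rf \<or> s + 2 * int k' < 2 * int k) k'
       (\<lambda>ws. Q ((k', s) # ws)) \<longlonglongrightarrow> \<delta> k' s"
  shows "profile_density lf rf k Q \<longlonglongrightarrow> (\<Sum>(k', s)\<in>A. \<delta> k' s / 2 ^ k') / (1 - real (card K) / 2 ^ k)"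
proof (rule linear_recurrence_tendsto[OF _ _ \<open>k \<ge> 1\<close>])
  have fin: "finite K" "finite A" using finite_steps[of lf rf k] assms(1) by auto
  let ?d = "\<lambda>n. \<Sum>(k', s)\<in>A. profile_density (lf \<or> 0 < s) (rf \<or> s + 2 * int k' < 2 * int k) k'
       (\<lambda>ws. Q ((k', s) # ws)) (n - k') / 2 ^ k'"
  show "?d \<longlonglongrightarrow> (\<Sum>(k', s)\<in>A. \<delta> k' s / 2 ^ k')"
  proof (rule tendsto_sum, clarify)
    fix k' s assume "(k', s) \<in> A"
    from tendsto_divide[OF seq_offset_neg[OF assms(6)[OF this]] tendsto_const]
    show "(\<lambda>n. profile_density (lf \<or> 0 < s) (rf \<or> s + 2 * int k' < 2 * int k) k'
       (\<lambda>ws. Q ((k', s) # ws)) (n - k') / 2 ^ k') \<longlonglongrightarrow> \<delta> k' s / 2 ^ k'" by simp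
  qed
  show "\<bar>real (card K) / 2 ^ k\<bar> < 1" using assms(3) by simp
  fix n assume n: "n \<ge> k + 1"
  have "profile_density lf rf k Q n =
    (\<Sum>(k', s)\<in>steps lf rf k. profile_density (lf \<or> 0 < s) (rf \<or> s + 2 * int k' < 2 * int k) k'
       (\<lambda>ws. Q ((k', s) # ws)) (n - k') / 2 ^ k')"
    using n by (intro profile_density_step) (auto simp: mem_steps)
  also have "\<dots> = (\<Sum>(k', s)\<in>K. profile_density (lf \<or> 0 < s) (rf \<or> s + 2 * int k' < 2 * int k) k'
       (\<lambda>ws. Q ((k', s) # ws)) (n - k') / 2 ^ k') + ?d n"
    unfolding assms(1) by (intro sum.union_disjoint fin assms(2))
  also have "(\<Sum>(k', s)\<in>K. profile_density (lf \<or> 0 < s) (rf \<or> s + 2 * int k' < 2 * int k) k'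
       (\<lambda>ws. Q ((k', s) # ws)) (n - k') / 2 ^ k') = (\<Sum>(k', s)\<in>K. profile_density lf rf k Q (n - k) / 2 ^ k)"
  proof (intro sum.cong refl, clarify)
    fix k' s assume "(k', s) \<in> K"
    from assms(5)[OF this, of "n - k'"]
    show "profile_density (lf \<or> 0 < s) (rf \<or> s + 2 * int k' < 2 * int k) k' (\<lambda>ws. Q ((k', s) # ws)) (n - k') / 2 ^ k' =
        profile_density lf rf k Q (n - k) / 2 ^ k" by metis
  qed
  also have "\<dots> = real (card K) / 2 ^ k * profile_density lf rf k Q (n - k)"
    by (simp add: case_prod_beta)
  finally show "profile_density lf rf k Q n = real (card K) / 2 ^ k * profile_density lf rf k Q (n - k) + ?d n" .
qed

section \<open>States in which some end has retreated\<close>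

lemma profile_density_True_True: "k \<ge> 1 \<Longrightarrow> profile_density True True k (\<lambda>_. True) \<longlonglongrightarrow> 0"
proof (induction k rule: less_induct)
  case (less k)
  let ?A = "{(k', s) \<in> steps True True k. k' < k}"
  \<comment> \<open>With both ends blocked a row repeats in one way only, so the coefficient
    \<open>1 / 2 ^ k\<close> is below 1; shorter rows have limit 0 by induction.\<close>
  have "profile_density True True k (\<lambda>_. True) \<longlonglongrightarrow>
      (\<Sum>(k', s)\<in>?A. 0 / 2 ^ k') / (1 - real (card {(k, 0::int)}) / 2 ^ k)"
  proof (rule profile_density_tendsto)
    show "steps True True k = {(k, 0)} \<union> ?A" using less.prems by (auto simp: mem_steps)
    show "real (card {(k, 0::int)}) < 2 ^ k" using less.prems by (simp add: one_less_power)
  qed (use less in \<open>auto simp: mem_steps\<close>)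
  then show ?case by (simp add: case_prod_beta)
qed

text \<open>The coefficient \<open>2 / 2 ^ k\<close> equals 1 at \<open>k = 1\<close>, out of reach
  of \<open>profile_density_tendsto\<close>; the two ways to add a single domino, each of weight
  1/2, keep the density constant.\<close>

lemma profile_density_False_True_1: "profile_density False True 1 (\<lambda>_. True) n = 1"
proof (induction n)
  case 0
  show ?case by (simp add: profile_density_def profile_count_0)
next
  case (Suc n)
  have "steps False True 1 = {(1, 0), (1, -1)}" by (auto simp: mem_steps)
  moreover have "profile_density False True 1 (\<lambda>_. True) (Suc n) = (\<Sum>(k', s)\<in>steps False True 1.
      profile_density (False \<or> 0 < s) (True \<or> s + 2 * int k' < 2 * int 1) k' (\<lambda>_. True) (Suc n - k') / 2 ^ k')"
    by (rule profile_density_step) (auto simp: mem_steps)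
  ultimately show ?case using Suc by simp
qed

lemma sum_left_tilt: "0 \<le> m \<Longrightarrow> (\<Sum>s\<in>{-1..m::int}. if 0 < s then 0 else c) = 2 * (c::real)"
proof -
  assume "0 \<le> m"
  then have "(\<Sum>s\<in>{-1, 0::int}. if 0 < s then 0 else c) = (\<Sum>s\<in>{-1..m::int}. if 0 < s then 0 else c)"
    by (intro sum.mono_neutral_left) auto
  then show ?thesis by simp
qed

text \<open>A row repeats with shift 0 or \<open>-1\<close>. Onto a shorter row the same two shifts
  keep the left flag down, all others having limit 0. By \<open>sum_partial_P\<close> the numerator
  is \<open>partial_P k * (1 - 2 / 2 ^ k)\<close>, and the denominator cancels its second
  factor.\<close>

lemma profile_density_False_True: "k \<ge> 1 \<Longrightarrow> profile_density False True k (\<lambda>_. True) \<longlonglongrightarrow> partial_P k"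
proof (induction k rule: less_induct)
  case (less k)
  show ?case
  proof (cases "k = 1")
    case True
    then show ?thesis using profile_density_False_True_1 by (simp add: fun_eq_iff[symmetric] lim_explicit)
  next
    case False
    let ?K = "{(k, 0::int), (k, -1)}"
    let ?A = "SIGMA k':{1..<k}. {-1..2 * int k - 2 * int k'}"
    have pow: "(2::real) < 2 ^ k" using False less.prems power_strict_increasing[of 1 k "2::real"] by simp
    have "profile_density False True k (\<lambda>_. True) \<longlonglongrightarrow>
      (\<Sum>(k', s)\<in>?A. (if 0 < s then 0 else partial_P k') / 2 ^ k') / (1 - real (card ?K) / 2 ^ k)"
    proof (rule profile_density_tendsto)
      show "steps False True k = ?K \<union> ?A" using less.prems by (auto simp: mem_steps)
      show "real (card ?K) < 2 ^ k" using pow by simp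
      fix k' s assume "(k', s) \<in> ?A"
      then have "k' < k" "k' \<ge> 1" by auto
      then show "profile_density (False \<or> 0 < s) (True \<or> s + 2 * int k' < 2 * int k) k' (\<lambda>_. True)
        \<longlonglongrightarrow> (if 0 < s then 0 else partial_P k')"
        using less.IH[of k'] profile_density_True_True[of k'] by (cases "0 < s") simp_all
    qed (use less.prems in auto)
    also have "(\<Sum>(k', s)\<in>?A. (if 0 < s then 0 else partial_P k') / 2 ^ k') =
        (\<Sum>k'\<in>{1..<k}. (\<Sum>s\<in>{-1..2 * int k - 2 * int k'}. if 0 < s then 0 else partial_P k') / 2 ^ k')"
      by (simp add: sum.Sigma sum_divide_distrib)
    also have "\<dots> = (\<Sum>k'\<in>{1..<k}. 2 * partial_P k' / 2 ^ k')"
      by (intro sum.cong refl, subst sum_left_tilt) auto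
    also have "\<dots> / (1 - real (card ?K) / 2 ^ k) = partial_P k"
      unfolding sum_partial_P[OF less.prems] using pow by simp
    finally show ?thesis .
  qed
qed

lemma profile_density_flagged:
  assumes "lf \<or> rf" "k \<ge> 1"
  shows "profile_density lf rf k (\<lambda>_. True) \<longlonglongrightarrow> limit_density lf rf k"
proof -
  have "profile_density True False k (\<lambda>_. True) = profile_density False True k (\<lambda>_. True)"
    by (simp add: profile_density_def fun_eq_iff profile_count_mirror[of True False])
  then show ?thesis
    using assms profile_density_False_True profile_density_True_True by (cases lf; cases rf) (simp_all add: limit_density_def)
qed

section \<open>States in which neither end has retreated\<close>

lemma profile_density_cong:
  assumes "\<And>ws. profile lf rf k ws \<Longrightarrow> Q ws \<longleftrightarrow> Q' ws"
  shows "profile_density lf rf k Q n = profile_density lf rf k Q' n"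
proof -
  have "{ws. profile lf rf k ws \<and> Q ws \<and> sum_list (map fst ws) = n} =
      {ws. profile lf rf k ws \<and> Q' ws \<and> sum_list (map fst ws) = n}" using assms by blast
  then show ?thesis by (simp add: profile_density_def profile_count_def)
qed

lemma profile_density_False: "profile_density lf rf k (\<lambda>_. False) = (\<lambda>_. 0)"
  by (simp add: profile_density_def profile_count_def fun_eq_iff)

text \<open>Two shifts keep the left end from retreating and two the right end; they are distinct as
  \<open>k' < b\<close>. Every shift in between raises both flags and contributes 0.\<close>

lemma sum_outer_tilt:
  assumes "1 \<le> k'" "k' < b"
  shows "(\<Sum>s\<in>{-1..2 * int b - 2 * int k' + 1}. limit_density (0 < s) (s + 2 * int k' < 2 * int b) k') =
    4 * partial_P k'"
proof -
  let ?m = "2 * int b - 2 * int k'"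
  have "(\<Sum>s\<in>{-1, 0, ?m, ?m + 1}. limit_density (0 < s) (s + 2 * int k' < 2 * int b) k') =
      (\<Sum>s\<in>{-1..?m + 1}. limit_density (0 < s) (s + 2 * int k' < 2 * int b) k')"
    using assms by (intro sum.mono_neutral_left) (auto simp: limit_density_def)
  moreover have "(\<Sum>s\<in>{-1, 0, ?m, ?m + 1}. limit_density (0 < s) (s + 2 * int k' < 2 * int b) k') =
      4 * partial_P k'"
    using assms by (simp add: limit_density_def)
  ultimately show ?thesis by simp
qed

text \<open>The maximum is already attained and must only not be exceeded. Growing to
  \<open>b + 1\<close> contributes 0, an exact repeat keeps the state, and any other step raises a
  flag, after which the condition holds automatically.\<close>

lemma profile_density_reaches_self:
  assumes "b \<ge> 1"
  shows "profile_density False False b (reaches b b) \<longlonglongrightarrow> 2 * partial_P b"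
proof -
  let ?K = "{(b, 0::int)}"
  let ?C = "SIGMA k':{1..<b}. {-1..2 * int b - 2 * int k' + 1}"
  let ?A = "{(b + 1, -1), (b, -1), (b, 1)} \<union> ?C"
  let ?l = "\<lambda>k' s. if k' = b + 1 then 0 else limit_density (0 < s) (s + 2 * int k' < 2 * int b) k'"
  have pow: "(1::real) < 2 ^ b" using assms by (simp add: one_less_power)
  have "profile_density False False b (reaches b b) \<longlonglongrightarrow>
      (\<Sum>(k', s)\<in>?A. ?l k' s / 2 ^ k') / (1 - real (card ?K) / 2 ^ b)"
  proof (rule profile_density_tendsto)
    show "steps False False b = ?K \<union> ?A" using assms by (auto simp: mem_steps)
    show "real (card ?K) < 2 ^ b" using pow by simp
    fix k' s n assume "(k', s) \<in> ?K"
    then show "profile_density (False \<or> 0 < s) (False \<or> s + 2 * int k' < 2 * int b) k'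
       (\<lambda>ws. reaches b b ((k', s) # ws)) n = profile_density False False b (reaches b b) n \<and> k' = b"
      by (auto simp: reaches_def[abs_def])
  next
    fix k' s assume A: "(k', s) \<in> ?A"
    show "profile_density (False \<or> 0 < s) (False \<or> s + 2 * int k' < 2 * int b) k'
       (\<lambda>ws. reaches b b ((k', s) # ws)) \<longlonglongrightarrow> ?l k' s"
    proof (cases "k' = b + 1")
      case True
      then have "(\<lambda>ws. reaches b b ((k', s) # ws)) = (\<lambda>_. False)" by (simp add: reaches_def)
      then show ?thesis using True by (simp add: profile_density_False)
    next
      case False
      let ?lf = "0 < s" and ?rf = "s + 2 * int k' < 2 * int b"
      have k': "1 \<le> k'" "k' \<le> b" "?lf \<or> ?rf" using A False assms by auto
      have "profile_density ?lf ?rf k' (\<lambda>ws. reaches b b ((k', s) # ws)) n = profile_density ?lf ?rf k' (\<lambda>_. True) n" for n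
        using profile_fst_le[OF _ k'(3)] k'(2)
        by (intro profile_density_cong) (fastforce simp: reaches_def)
      then have "profile_density ?lf ?rf k' (\<lambda>ws. reaches b b ((k', s) # ws)) = profile_density ?lf ?rf k' (\<lambda>_. True)"
        by (rule ext)
      then show ?thesis using profile_density_flagged[OF k'(3,1)] False by simp
    qed
  qed (use assms in auto)
  also have "(\<Sum>(k', s)\<in>?A. ?l k' s / 2 ^ k') =
      (\<Sum>(k', s)\<in>{(b + 1, -1), (b, -1), (b, 1)}. ?l k' s / 2 ^ k') + (\<Sum>(k', s)\<in>?C. ?l k' s / 2 ^ k')"
    by (intro sum.union_disjoint) auto
  also have "(\<Sum>(k', s)\<in>{(b + 1, -1), (b, -1), (b, 1)}. ?l k' s / 2 ^ k') = 2 * partial_P b / 2 ^ b"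
    by (simp add: limit_density_def)
  also have "(\<Sum>(k', s)\<in>?C. ?l k' s / 2 ^ k') =
      (\<Sum>k'\<in>{1..<b}. \<Sum>s\<in>{-1..2 * int b - 2 * int k' + 1}. ?l k' s / 2 ^ k')"
    by (rule sum.Sigma[symmetric]) auto
  also have "\<dots> = (\<Sum>k'\<in>{1..<b}. (\<Sum>s\<in>{-1..2 * int b - 2 * int k' + 1}.
      limit_density (0 < s) (s + 2 * int k' < 2 * int b) k') / 2 ^ k')"
    by (intro sum.cong refl) (simp add: sum_divide_distrib)
  also have "\<dots> = (\<Sum>k'\<in>{1..<b}. 2 * (2 * partial_P k' / 2 ^ k'))"
    by (intro sum.cong refl) (simp add: sum_outer_tilt)
  also have "\<dots> = 2 * (partial_P b * (1 - 2 / 2 ^ b))"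
    unfolding sum_distrib_left[symmetric] sum_partial_P[OF assms] ..
  also have "(2 * partial_P b / 2 ^ b + 2 * (partial_P b * (1 - 2 / 2 ^ b))) / (1 - real (card ?K) / 2 ^ b) =
      2 * partial_P b"
    using pow by (simp add: field_simps)
  finally show ?thesis .
qed

text \<open>Below length \<open>b\<close> no end may retreat, so the only useful steps are an exact
  repeat and growth by one domino. Solving for the limit at \<open>k\<close> in terms of that at
  \<open>Suc k\<close> gives the factor \<open>1 / (2 ^ k - 1)\<close>.\<close>

lemma profile_density_reaches:
  assumes "k \<ge> 1" "k \<le> b"
  shows "profile_density False False k (reaches b k) \<longlonglongrightarrow>
    2 ^ k * (2 * partial_P b / 2 ^ b * (\<Prod>j = k..<b. 1 / (2 ^ j - 1)))"
  using assms(2,1)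
proof (induction k rule: inc_induct)
  case base
  then show ?case using profile_density_reaches_self by simp
next
  case (step k)
  define \<phi> where "\<phi> = 2 ^ Suc k * (2 * partial_P b / 2 ^ b * (\<Prod>j = Suc k..<b. 1 / (2 ^ j - 1)))"
  let ?K = "{(k, 0::int)}"
  let ?A = "steps False False k - ?K"
  let ?l = "\<lambda>k' (s::int). if k' = Suc k then \<phi> else 0"
  have pow: "(1::real) < 2 ^ k" using step by (simp add: one_less_power)
  have Q: "reaches b k ((k', s) # ws) \<longleftrightarrow> reaches b k' ws" for k' s ws
    using step.hyps by (auto simp: reaches_def)
  have "profile_density False False k (reaches b k) \<longlonglongrightarrow>
      (\<Sum>(k', s)\<in>?A. ?l k' s / 2 ^ k') / (1 - real (card ?K) / 2 ^ k)"
  proof (rule profile_density_tendsto; (unfold Q)?)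
    show "steps False False k = ?K \<union> ?A" using step.prems by (auto simp: mem_steps)
    show "real (card ?K) < 2 ^ k" using pow by simp
    fix k' s assume A: "(k', s) \<in> ?A"
    let ?lf = "0 < s" and ?rf = "s + 2 * int k' < 2 * int k"
    show "profile_density (False \<or> ?lf) (False \<or> ?rf) k' (reaches b k') \<longlonglongrightarrow> ?l k' s"
    proof (cases "k' = Suc k")
      case True
      then show ?thesis using A step.IH by (auto simp: mem_steps \<phi>_def)
    next
      case False
      then have k': "k' \<le> k" "?lf \<or> ?rf" using A by (auto simp: mem_steps)
      \<comment> \<open>A retreated end bars growth, so a row of length \<open>b\<close> is out of
        reach.\<close>
      have "profile_density ?lf ?rf k' (reaches b k') n = profile_density ?lf ?rf k' (\<lambda>_. False) n" for n
        using profile_fst_le[OF _ k'(2)] k'(1) step.hyps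
        by (intro profile_density_cong) (fastforce simp: reaches_def)
      then have "profile_density ?lf ?rf k' (reaches b k') = (\<lambda>_. 0)" by (intro ext) (simp only: profile_density_False)
      then show ?thesis using False by simp
    qed
  qed (use step.prems in auto)
  also have "(\<Sum>(k', s)\<in>?A. ?l k' s / 2 ^ k') = (\<Sum>(k', s)\<in>{(Suc k, -1)}. ?l k' s / 2 ^ k')"
    using finite_steps by (intro sum.mono_neutral_right) (auto simp: mem_steps)
  also have "\<dots> / (1 - real (card ?K) / 2 ^ k) =
      2 ^ k * (2 * partial_P b / 2 ^ b * (\<Prod>j = k..<b. 1 / (2 ^ j - 1)))"
    using pow step.hyps by (simp add: \<phi>_def prod.atLeast_Suc_lessThan field_simps)
  finally show ?case .
qed

section \<open>Summing over base lengths\<close>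

lemma card_tower_profiles:
  "card (tower_profiles b n) =
     (\<Sum>k = 1..b. if k \<le> n then profile_count False False k (reaches b k) (n - k) else 0)"
proof -
  let ?B = "\<lambda>k. {ws. profile False False k ws \<and> reaches b k ws \<and> sum_list (map fst ws) = n - k}"
  have eq: "tower_profiles b n = (SIGMA k:{k \<in> {1..b}. k \<le> n}. ?B k)"
    by (auto simp: tower_profiles_def reaches_def)
  have "card (SIGMA k:{k \<in> {1..b}. k \<le> n}. ?B k) = (\<Sum>k\<in>{k \<in> {1..b}. k \<le> n}. card (?B k))"
    using finite_profiles by (intro card_SigmaI) auto
  then show ?thesis
    unfolding eq profile_count_def by (simp only: sum.inter_filter[OF finite_atLeastAtMost])
qed

text \<open>The \<open>k\<close> base dominoes contribute the weight \<open>1 / 2 ^ k\<close>, which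
  cancels the \<open>2 ^ k\<close> in \<open>profile_density_reaches\<close>; the remaining products
  sum to \<open>ascent_factor b\<close>.\<close>

lemma num_convex_towers_tendsto:
  assumes "b \<ge> 1"
  shows "(\<lambda>n. real (num_convex_towers b n) / 2 ^ n) \<longlonglongrightarrow>
    (1 / 2) ^ (b - 1) * partial_P b * ascent_factor b"
proof -
  have "(\<lambda>n. \<Sum>k = 1..b. profile_density False False k (reaches b k) (n - k) / 2 ^ k) \<longlonglongrightarrow>
      (\<Sum>k = 1..b. 2 ^ k * (2 * partial_P b / 2 ^ b * (\<Prod>j = k..<b. 1 / (2 ^ j - 1))) / 2 ^ k)"
  proof (rule tendsto_sum)
    fix k assume "k \<in> {1..b}"
    then have "1 \<le> k" "k \<le> b" by auto
    then show "(\<lambda>n. profile_density False False k (reaches b k) (n - k) / 2 ^ k) \<longlonglongrightarrow>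
      2 ^ k * (2 * partial_P b / 2 ^ b * (\<Prod>j = k..<b. 1 / (2 ^ j - 1))) / 2 ^ k"
      by (intro tendsto_divide[OF seq_offset_neg[OF profile_density_reaches] tendsto_const]) auto
  qed
  also have "(\<Sum>k = 1..b. 2 ^ k * (2 * partial_P b / 2 ^ b * (\<Prod>j = k..<b. 1 / (2 ^ j - 1))) / 2 ^ k) =
      2 * partial_P b / 2 ^ b * ascent_factor b"
    by (simp add: ascent_factor_def sum_distrib_left)
  also have "\<dots> = (1 / 2) ^ (b - 1) * partial_P b * ascent_factor b"
    using assms by (cases b) (simp_all add: power_divide)
  finally show ?thesis
  proof (rule Lim_transform_eventually)
    show "\<forall>\<^sub>F n in sequentially. (\<Sum>k = 1..b. profile_density False False k (reaches b k) (n - k) / 2 ^ k) =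
      real (num_convex_towers b n) / 2 ^ n"
      using eventually_ge_at_top[of b]
    proof eventually_elim
      case (elim n)
      have "real (if k \<le> n then profile_count False False k (reaches b k) (n - k) else 0) / 2 ^ n =
          profile_density False False k (reaches b k) (n - k) / 2 ^ k" if "k \<in> {1..b}" for k
      proof -
        have "(2::real) ^ n = 2 ^ (n - k) * 2 ^ k" using that elim by (simp flip: power_add)
        then show ?thesis using that elim by (simp add: profile_density_def)
      qed
      then show ?case
        by (simp add: num_convex_towers_eq_card[OF assms] card_tower_profiles sum_divide_distrib)
    qed
  qed
qed

theorem theorem3p2:
  shows "(\<forall>b>1. convergent (\<lambda>n. real (num_convex_towers b n) / 2 ^ n) \<and> tower_theta b \<noteq> 0 \<and>
            (\<lambda>n. real (num_convex_towers b n)) \<sim>[at_top] (\<lambda>n. tower_theta b * 2 ^ n)) \<and>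
         tower_theta \<sim>[at_top]
           (\<lambda>b. (1 / 2) ^ (b - 1) * (\<Prod>k = 1..b - 1. 2 ^ k / (2 ^ k - 1))) \<and>
         tower_theta \<sim>[at_top] (\<lambda>b. tower_P * (1 / 2) ^ (b - 1)) \<and>
         convergent_prod (\<lambda>k. 2 ^ Suc k / (2 ^ Suc k - 1) :: real) \<and>
         real_of_int (round (100 * tower_P)) / 100 = 3.46"
proof (intro conjI allI impI)
  have theta: "tower_theta b = (1 / 2) ^ (b - 1) * partial_P b * ascent_factor b" if "b \<ge> 1" for b
    unfolding tower_theta_def using limI[OF num_convex_towers_tendsto[OF that]] .
  {
    fix b :: nat assume "b > 1"
    then have b: "b \<ge> 1" by simp
    note lim = num_convex_towers_tendsto[OF b]
    show "convergent (\<lambda>n. real (num_convex_towers b n) / 2 ^ n)"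
      using lim by (rule convergentI)
    show nz: "tower_theta b \<noteq> 0"
      using theta[OF b] partial_P_pos[of b] ascent_factor_bounds[OF b] by auto
    have "(\<lambda>n. real (num_convex_towers b n) / 2 ^ n / tower_theta b) \<longlonglongrightarrow> tower_theta b / tower_theta b"
      using lim nz unfolding theta[OF b, symmetric] by (intro tendsto_divide) auto
    then show "(\<lambda>n. real (num_convex_towers b n)) \<sim>[at_top] (\<lambda>n. tower_theta b * 2 ^ n)"
      using nz by (intro asymp_equivI') (simp add: mult.commute)
  }
  show equiv: "tower_theta \<sim>[at_top] (\<lambda>b. (1 / 2) ^ (b - 1) * (\<Prod>k = 1..b - 1. 2 ^ k / (2 ^ k - 1)))"
  \<comment> \<open>For \<open>b >= 1\<close> the quotient of the two sides is exactly
    \<open>ascent_factor b\<close>, which tends to 1.\<close>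
  proof (rule asymp_equivI', rule Lim_transform_eventually[OF ascent_factor_tendsto])
    show "\<forall>\<^sub>F b in sequentially. ascent_factor b =
        tower_theta b / ((1 / 2) ^ (b - 1) * (\<Prod>k = 1..b - 1. 2 ^ k / (2 ^ k - 1)))"
      using eventually_ge_at_top[of 1]
    proof eventually_elim
      case (elim b)
      have "{1..b - 1} = {1..<b}" by auto
      then have "(\<Prod>k = 1..b - 1. 2 ^ k / (2 ^ k - 1)) = partial_P b"
        by (simp only: partial_P_def)
      then show ?case using theta[OF elim] partial_P_pos[of b] by simp
    qed
  qed
  have P_pos: "tower_P > 0" using tower_P_bounds(1)[of 1] by simp
  show "tower_theta \<sim>[at_top] (\<lambda>b. tower_P * (1 / 2) ^ (b - 1))"
  proof (rule asymp_equivI')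
    have "(\<lambda>b. partial_P b * ascent_factor b / tower_P) \<longlonglongrightarrow> tower_P * 1 / tower_P"
      using P_pos by (intro tendsto_intros partial_P_tendsto ascent_factor_tendsto) auto
    moreover have "\<forall>\<^sub>F b in sequentially. partial_P b * ascent_factor b / tower_P =
        tower_theta b / (tower_P * (1 / 2) ^ (b - 1))"
      using eventually_ge_at_top[of 1] by eventually_elim (simp add: theta)
    ultimately show "(\<lambda>b. tower_theta b / (tower_P * (1 / 2) ^ (b - 1))) \<longlonglongrightarrow> 1"
      using P_pos by (simp add: Lim_transform_eventually)
  qed
  show "convergent_prod (\<lambda>k. 2 ^ Suc k / (2 ^ Suc k - 1) :: real)" by (rule convergent_prod_P)
  show "real_of_int (round (100 * tower_P)) / 100 = 3.46" by (simp add: round_tower_P)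
qed

end
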